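(* Let $\beta\in(0,3)$ and let $(q,\lambda)$ be a localization pair on $\Omega=(0,1)$ (as defined in the context). Then there exists a constant $C>0$, independent of $h$ and $\delta$, such that the following holds for every $\delta\in(0,\delta_* )$, every $h=1/N$ with $N\ge1$ an integer, and every $f\in L^2(\Omega)$. Let $u_0\in H^2(\Omega)\cap H_0^1(\Omega)$ solve the local weak problem for $-u_0''=f$ with $u_0(0)=u_0(1)=0$, and let $u_{\delta,h}\in V_h\subset\mathfrak W_0^{\beta,2}[\delta;q](\Omega)$ solve $\mathcal B_\delta(u_{\delta,h},v_h)=(f,v_h)$ for all $v_h\in V_h$. Then $$\|u_{\delta,h}-u_0\|_{\mathfrak W^{\beta,2}[\delta;q](\Omega)}\le C\Bigg(\inf_{v_h\in V_h}\|u_0-v_h\|_{\mathfrak W^{\beta,2}[\delta;q](\Omega)}+\sup_{0\ne w_h\in V_h}\frac{|\mathcal B_\delta(u_0,w_h)-\mathcal B_0(u_0,w_h)|}{\|w_h\|_{\mathfrak W^{\beta,2}[\delta;q](\Omega)}}\Bigg),$$ where $\mathcal B_0(u_0,w):=(-u_0'',w)$.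
   Context: Let $\Omega=(0,1)$, $d(x)=\operatorname{dist}(x,\partial\Omega)$, $\beta\in(0,3)$, and $(\cdot,\cdot)$ the $L^2(\Omega)$ inner product. Localization pair: functions $q:[0,\infty)\to[0,\infty)$ and $\lambda:\overline\Omega\to[0,\infty)$, together with constants $C_q\ge1$, $\kappa_0\ge1$, $\kappa_1,\kappa_2>0$, such that: (1) $q\in C^3([0,\infty))$, $q(0)=q'(0)=0$, $q''(0)>0$; $0<q(r)\le r$ for $r>0$; $0\le q'(r)\le1$ and $0\le q''(r)\le1$ for $r\ge0$; $q''\in C_b^1([0,\infty))$ (bounded with bounded continuous derivative); $q(2r)\le C_q q(r)$ for $r>0$. (2) $\lambda\in C^0(\overline\Omega)\cap C^2(\Omega)$; $\kappa_0^{-1}d(x)\le\lambda(x)\le\kappa_0 d(x)$ on $\overline\Omega$; $|\lambda(x)-\lambda(y)|\le\kappa_1|x-y|$ for $x,y\in\Omega$; $|\lambda^{(j)}(x)|\le\kappa_j d(x)^{1-j}$ for $x\in\Omega$, $j=0,1,2$; $\lambda'(0^+)=1$, $\lambda'(1^-)=-1$. Range of $\delta$: $\delta_*:=\min\{\delta_0,\bar\delta_0\}$, where $\delta_0=\bigl(3\max\{1,\kappa_1,C_q\kappa_0^{\log_2 C_q}\}\bigr)^{-1}$ and $\bar\delta_0$ is the smallest positive root of $\frac{\delta(1+\kappa_1\delta)}{(1-\kappa_1\delta)^2}=\frac13$. Put $\eta(x)=q(\lambda(x))$, $\eta_\delta(x)=\delta\eta(x)$, $C_\beta=\frac{3-\beta}{2}$,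 $w_\delta(x)=C_\beta\,\eta_\delta(x)^{-(3-\beta)}$. Bilinear form, spaces and norm: $$\mathcal B_\delta(u,v)=\int_0^1\int_0^1 w_\delta(x)\mathbf 1_{\{|y-x|<\eta_\delta(x)\}}\frac{(u(x)-u(y))(v(x)-v(y))}{|x-y|^\beta}\,dy\,dx;$$ $\mathfrak W^{\beta,2}[\delta;q](\Omega)$ is the Hilbert space of $u\in L^2(\Omega)$ with $\mathcal B_\delta(u,u)<\infty$, with norm $\|u\|_{\mathfrak W^{\beta,2}[\delta;q](\Omega)}=(\|u\|_{L^2(\Omega)}^2+\mathcal B_\delta(u,u))^{1/2}$. The boundary trace map $T$ (restriction to $\partial\Omega=\{0,1\}$ for functions smooth up to the boundary) extends continuously to this space, and $\mathfrak W_0^{\beta,2}[\delta;q](\Omega)$ is the subspace $\{Tu=0\}$; it coincides with the closure of $C_c^1(\Omega)$ in $\mathfrak W^{\beta,2}[\delta;q](\Omega)$. One has $H_0^1(\Omega)\subset\mathfrak W_0^{\beta,2}[\delta;q](\Omega)$. Finite element space: for an integer $N\ge1$, $h=1/N$, $x_i=ih$, $V_h$ is the space of $v_h\in C^0([0,1])$ that are affine on each $(x_{i-1},x_i]$, $i=1,\dots,N$, with $v_h(0)=v_h(1)=0$. The supremum over an empty set (the case $N=1$, $V_h=\{0\}$) is read as $0$. *)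

theory Defs
  imports "HOL-Analysis.Analysis"
begin

abbreviation Omega :: "real set" ("\<Omega>")
  where "\<Omega> \<equiv> {0<..<1}"

definition bdist :: "real \<Rightarrow> real"
  where "bdist x = infdist x (frontier \<Omega>)"


section \<open>Localization pairs\<close>

text \<open>The derivatives of \<open>q\<close> at \<open>0\<close> are one-sided. The functions \<open>q1\<close>, \<open>q2\<close>, \<open>q3\<close>
  and \<open>l1\<close>, \<open>l2\<close> are the successive derivatives, determined by \<open>q\<close> on \<open>[0,\<infinity>)\<close>
  and by \<open>lam\<close> on \<open>\<Omega>\<close> respectively.\<close>

definition localization_profile :: "(real \<Rightarrow> real) \<Rightarrow> real \<Rightarrow> bool"
  where "localization_profile q Cq \<longleftrightarrow>
    (\<exists>q1 q2 q3.
      (\<forall>r\<ge>0. (q has_real_derivative q1 r) (at r within {0..})) \<and>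
      (\<forall>r\<ge>0. (q1 has_real_derivative q2 r) (at r within {0..})) \<and>
      (\<forall>r\<ge>0. (q2 has_real_derivative q3 r) (at r within {0..})) \<and>
      continuous_on {0..} q3 \<and> bounded (q2 ` {0..}) \<and> bounded (q3 ` {0..}) \<and>
      q 0 = 0 \<and> q1 0 = 0 \<and> q2 0 > 0 \<and>
      (\<forall>r>0. 0 < q r \<and> q r \<le> r) \<and>
      (\<forall>r\<ge>0. 0 \<le> q1 r \<and> q1 r \<le> 1) \<and>
      (\<forall>r\<ge>0. 0 \<le> q2 r \<and> q2 r \<le> 1)) \<and>
    (\<forall>r>0. q (2 * r) \<le> Cq * q r)"

definition generalized_distance :: "(real \<Rightarrow> real) \<Rightarrow> real \<Rightarrow> real \<Rightarrow> real \<Rightarrow> bool"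
  where "generalized_distance lam k0 k1 k2 \<longleftrightarrow>
    continuous_on {0..1} lam \<and>
    (\<forall>x\<in>{0..1}. 0 \<le> lam x) \<and>
    (\<forall>x\<in>{0..1}. inverse k0 * bdist x \<le> lam x \<and> lam x \<le> k0 * bdist x) \<and>
    (\<forall>x\<in>\<Omega>. \<forall>y\<in>\<Omega>. \<bar>lam x - lam y\<bar> \<le> k1 * \<bar>x - y\<bar>) \<and>
    (\<exists>l1 l2.
      (\<forall>x\<in>\<Omega>. (lam has_real_derivative l1 x) (at x)) \<and>
      (\<forall>x\<in>\<Omega>. (l1 has_real_derivative l2 x) (at x)) \<and>
      continuous_on \<Omega> l2 \<and>
      (\<forall>x\<in>\<Omega>. \<bar>lam x\<bar> \<le> k0 * bdist x \<and> \<bar>l1 x\<bar> \<le> k1 \<and> \<bar>l2 x\<bar> \<le> k2 / bdist x) \<and>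
      (l1 \<longlongrightarrow> 1) (at_right 0) \<and> (l1 \<longlongrightarrow> -1) (at_left 1))"

definition localization_pair ::
    "(real \<Rightarrow> real) \<Rightarrow> (real \<Rightarrow> real) \<Rightarrow> real \<Rightarrow> real \<Rightarrow> real \<Rightarrow> real \<Rightarrow> bool"
  where "localization_pair q lam Cq k0 k1 k2 \<longleftrightarrow>
    Cq \<ge> 1 \<and> k0 \<ge> 1 \<and> k1 > 0 \<and> k2 > 0 \<and>
    localization_profile q Cq \<and> generalized_distance lam k0 k1 k2"

definition delta_0 :: "real \<Rightarrow> real \<Rightarrow> real \<Rightarrow> real"
  where "delta_0 Cq k0 k1 = inverse (3 * Max {1, k1, Cq * k0 powr (log 2 Cq)})"

text \<open>The equation is equivalent to a quadratic one with exactly one root in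
  \<open>(0, 1/k1)\<close>, so the smallest positive root exists. At \<open>\<delta> = 1/k1\<close> the quotient is \<open>0\<close>
  by the library convention, so this point is not a spurious root.\<close>

definition delta_bar_0 :: "real \<Rightarrow> real"
  where "delta_bar_0 k1 =
    (LEAST \<delta>. 0 < \<delta> \<and> \<delta> * (1 + k1 * \<delta>) / (1 - k1 * \<delta>)\<^sup>2 = 1 / 3)"

definition delta_star :: "real \<Rightarrow> real \<Rightarrow> real \<Rightarrow> real"
  where "delta_star Cq k0 k1 = min (delta_0 Cq k0 k1) (delta_bar_0 k1)"


section \<open>Lebesgue and Sobolev spaces on the interval\<close>

text \<open>Elements of these spaces are represented by functions on \<open>\<real>\<close>; only their values on
  \<open>\<Omega>\<close> matter, and every notion below is invariant under changes on null sets.\<close>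

definition L2 :: "(real \<Rightarrow> real) set"
  where "L2 = {u. u \<in> borel_measurable (lebesgue_on \<Omega>) \<and>
                  integrable (lebesgue_on \<Omega>) (\<lambda>x. (u x)\<^sup>2)}"

definition L2_inner :: "(real \<Rightarrow> real) \<Rightarrow> (real \<Rightarrow> real) \<Rightarrow> real"
  where "L2_inner u v = (\<integral>x. u x * v x \<partial>lebesgue_on \<Omega>)"

definition L2_norm :: "(real \<Rightarrow> real) \<Rightarrow> real"
  where "L2_norm u = sqrt (L2_inner u u)"

text \<open>\<open>C\<^sub>c\<^sup>\<infinity>(\<Omega>)\<close>, extended by zero to the real line.\<close>

definition test_functions :: "(real \<Rightarrow> real) set"
  where "test_functions = {\<phi>.
    (\<forall>n x. (deriv ^^ n) \<phi> differentiable (at x)) \<and>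
    (\<exists>K. compact K \<and> K \<subseteq> \<Omega> \<and> (\<forall>x. x \<notin> K \<longrightarrow> \<phi> x = 0))}"

definition has_weak_deriv :: "(real \<Rightarrow> real) \<Rightarrow> (real \<Rightarrow> real) \<Rightarrow> bool"
  where "has_weak_deriv u g \<longleftrightarrow> u \<in> L2 \<and> g \<in> L2 \<and>
    (\<forall>\<phi>\<in>test_functions. L2_inner u (deriv \<phi>) = - L2_inner g \<phi>)"

text \<open>Weak derivatives are unique almost everywhere; the choice picks a representative.\<close>

definition weak_deriv :: "(real \<Rightarrow> real) \<Rightarrow> real \<Rightarrow> real"
  where "weak_deriv u = (SOME g. has_weak_deriv u g)"

definition H1 :: "(real \<Rightarrow> real) set"
  where "H1 = {u. \<exists>g. has_weak_deriv u g}"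

definition H1_norm :: "(real \<Rightarrow> real) \<Rightarrow> real"
  where "H1_norm u = sqrt ((L2_norm u)\<^sup>2 + (L2_norm (weak_deriv u))\<^sup>2)"

definition H2 :: "(real \<Rightarrow> real) set"
  where "H2 = {u \<in> H1. weak_deriv u \<in> H1}"

definition H1_0 :: "(real \<Rightarrow> real) set"
  where "H1_0 = {u \<in> H1. \<forall>\<epsilon>>0. \<exists>\<phi>\<in>test_functions. H1_norm (\<lambda>x. u x - \<phi> x) < \<epsilon>}"

definition local_weak_solution :: "(real \<Rightarrow> real) \<Rightarrow> (real \<Rightarrow> real) \<Rightarrow> bool"
  where "local_weak_solution f u \<longleftrightarrow> u \<in> H1_0 \<and>
    (\<forall>v\<in>H1_0. L2_inner (weak_deriv u) (weak_deriv v) = L2_inner f v)"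

definition B_local :: "(real \<Rightarrow> real) \<Rightarrow> (real \<Rightarrow> real) \<Rightarrow> real"
  where "B_local u w = L2_inner (\<lambda>x. - weak_deriv (weak_deriv u) x) w"


section \<open>The nonlocal form and its energy space\<close>

definition eta :: "(real \<Rightarrow> real) \<Rightarrow> (real \<Rightarrow> real) \<Rightarrow> real \<Rightarrow> real \<Rightarrow> real"
  where "eta q lam \<delta> x = \<delta> * q (lam x)"

definition weight :: "real \<Rightarrow> (real \<Rightarrow> real) \<Rightarrow> (real \<Rightarrow> real) \<Rightarrow> real \<Rightarrow> real \<Rightarrow> real"
  where "weight \<beta> q lam \<delta> x = (3 - \<beta>) / 2 * eta q lam \<delta> x powr (- (3 - \<beta>))"

definition nl_integrand ::
    "real \<Rightarrow> (real \<Rightarrow> real) \<Rightarrow> (real \<Rightarrow> real) \<Rightarrow> real \<Rightarrow>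
     (real \<Rightarrow> real) \<Rightarrow> (real \<Rightarrow> real) \<Rightarrow> real \<Rightarrow> real \<Rightarrow> real"
  where "nl_integrand \<beta> q lam \<delta> u v x y =
    weight \<beta> q lam \<delta> x * indicator {y. \<bar>y - x\<bar> < eta q lam \<delta> x} y *
    ((u x - u y) * (v x - v y) / \<bar>x - y\<bar> powr \<beta>)"

definition B_nl ::
    "real \<Rightarrow> (real \<Rightarrow> real) \<Rightarrow> (real \<Rightarrow> real) \<Rightarrow> real \<Rightarrow>
     (real \<Rightarrow> real) \<Rightarrow> (real \<Rightarrow> real) \<Rightarrow> real"
  where "B_nl \<beta> q lam \<delta> u v =
    (\<integral>x. (\<integral>y. nl_integrand \<beta> q lam \<delta> u v x y \<partial>lebesgue_on \<Omega>) \<partial>lebesgue_on \<Omega>)"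

definition W_space :: "real \<Rightarrow> (real \<Rightarrow> real) \<Rightarrow> (real \<Rightarrow> real) \<Rightarrow> real \<Rightarrow> (real \<Rightarrow> real) set"
  where "W_space \<beta> q lam \<delta> = {u \<in> L2.
    (\<integral>\<^sup>+x. (\<integral>\<^sup>+y. ennreal (nl_integrand \<beta> q lam \<delta> u u x y) \<partial>lebesgue_on \<Omega>)
      \<partial>lebesgue_on \<Omega>) < \<infinity>}"

text \<open>The norm takes the value \<open>\<infinity>\<close> outside the space. With values in \<^typ>\<open>ennreal\<close>,
  infima and suprema of norms and of quotients are the honest extended ones; in particular
  the supremum of the empty set is \<open>0\<close>.\<close>

definition W_norm ::
    "real \<Rightarrow> (real \<Rightarrow> real) \<Rightarrow> (real \<Rightarrow> real) \<Rightarrow> real \<Rightarrow> (real \<Rightarrow> real) \<Rightarrow> ennreal"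
  where "W_norm \<beta> q lam \<delta> u =
    (if u \<in> W_space \<beta> q lam \<delta>
     then ennreal (sqrt ((L2_norm u)\<^sup>2 + B_nl \<beta> q lam \<delta> u u)) else \<infinity>)"


section \<open>Finite elements\<close>

text \<open>Here \<open>h = 1/N\<close>. The values of an element outside \<open>[0,1]\<close> are irrelevant, so being
  nonzero must be read on \<open>[0,1]\<close>.\<close>

definition fe_space :: "nat \<Rightarrow> (real \<Rightarrow> real) set"
  where "fe_space N = {v. continuous_on {0..1} v \<and> v 0 = 0 \<and> v 1 = 0 \<and>
    (\<forall>i\<in>{1..N}. \<exists>a b. \<forall>x\<in>{(real i - 1) / real N <.. real i / real N}. v x = a + b * x)}"

definition fe_nonzero :: "nat \<Rightarrow> (real \<Rightarrow> real) set"
  where "fe_nonzero N = {v \<in> fe_space N. \<exists>x\<in>{0..1}. v x \<noteq> 0}"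

definition discrete_solution ::
    "real \<Rightarrow> (real \<Rightarrow> real) \<Rightarrow> (real \<Rightarrow> real) \<Rightarrow> real \<Rightarrow> nat \<Rightarrow>
     (real \<Rightarrow> real) \<Rightarrow> (real \<Rightarrow> real) \<Rightarrow> bool"
  where "discrete_solution \<beta> q lam \<delta> N f u \<longleftrightarrow> u \<in> fe_space N \<and>
    (\<forall>v\<in>fe_space N. B_nl \<beta> q lam \<delta> u v = L2_inner f v)"

end

theory Submission
  imports Defs
begin

text \<open>For \<open>v \<in> V\<^sub>h\<close> put \<open>w = u\<^sub>h - v\<close>. Then
  \<open>B\<^sub>\<delta>(w, w) = B\<^sub>\<delta>(u\<^sub>0 - v, w) - (B\<^sub>\<delta>(u\<^sub>0, w) - B\<^sub>0(u\<^sub>0, w))\<close>, because \<open>-u\<^sub>0'' = f\<close> almost everywhere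
  by the fundamental lemma of the calculus of variations. Given a Poincare inequality
  \<open>\<parallel>w\<parallel>\<^sup>2 \<le> K B\<^sub>\<delta>(w, w)\<close> with \<open>K\<close> independent of \<open>\<delta>\<close> and \<open>h\<close>, this is the second Strang lemma.

  For the Poincare inequality, average \<open>w\<close> over \<open>(x, x + \<eta>\<^sub>\<delta>(x))\<close> with a linear kernel vanishing at the far
  end. Since \<open>\<bar>\<eta>\<^sub>\<delta>'\<bar> \<le> 1/3\<close> and \<open>\<eta>\<^sub>\<delta>(x) \<le> d(x)/3\<close>, both the derivative of the average \<open>A\<close> and the
  difference \<open>A - w\<close> are bounded pointwise, up to constants, by the energy density at \<open>x\<close>; and \<open>A\<close>
  inherits the boundary value \<open>0\<close>, so \<open>A(x)\<^sup>2 \<le> \<integral> (A')\<^sup>2\<close>.\<close>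

subsection \<open>The fundamental lemma of the calculus of variations\<close>

text \<open>The functions exp(-1/t) / t^k on the positive half-line, extended by zero;
  \<open>k = 0\<close> is the classical smooth function that is flat at the origin. Carrying the
  powers of \<open>t\<close> along makes the family closed under differentiation up to linear
  combinations.\<close>

definition flat :: "nat \<Rightarrow> real \<Rightarrow> real"
  where "flat k t = (if t \<le> 0 then 0 else exp (- 1 / t) / t ^ k)"

lemma flat_has_real_derivative:
  "(flat k has_real_derivative (flat (k + 2) t - real k * flat (Suc k) t)) (at t)"
proof (cases t "0::real" rule: linorder_cases)
  case less
  have "(flat k has_real_derivative 0) (at t)"
  proof (rule DERIV_cong_ev [THEN iffD1, rotated 3])
    show "((\<lambda>_. 0) has_real_derivative 0) (at t)" by simp
    show "\<forall>\<^sub>F s in nhds t. 0 = flat k s"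
      using eventually_nhds_in_open [of "{..<0}" t] less
      by (auto elim!: eventually_mono simp: flat_def)
  qed auto
  then show ?thesis using less by (simp add: flat_def)
next
  case equal
  have "((\<lambda>s. flat k s / s) \<longlongrightarrow> 0) (at 0)"
  proof (rule filterlim_split_at_real)
    show "((\<lambda>s. flat k s / s) \<longlongrightarrow> 0) (at_left 0)"
      by (rule tendsto_eventually) (auto simp: flat_def eventually_at_filter)
    \<comment> \<open>In the variable 1/s the difference quotient at the origin is a power over an
      exponential at infinity.\<close>
    have "((\<lambda>s. inverse s ^ Suc k / exp (inverse s)) \<longlongrightarrow> 0) (at_right (0::real))"
      by (rule filterlim_compose [OF tendsto_power_div_exp_0 filterlim_inverse_at_top_right])
    then show "((\<lambda>s. flat k s / s) \<longlongrightarrow> 0) (at_right 0)"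
      by (rule Lim_transform_eventually)
        (auto simp: flat_def eventually_at_filter exp_minus field_simps)
  qed
  then show ?thesis using equal by (simp add: has_field_derivative_iff flat_def)
next
  case greater
  have "((\<lambda>t. exp (- 1 / t) / t ^ k) has_real_derivative
      (flat (k + 2) t - real k * flat (Suc k) t)) (at t)"
    using greater
    by (auto intro!: derivative_eq_intros simp: flat_def)
      (cases k; auto simp: field_simps power2_eq_square)
  moreover have "\<forall>\<^sub>F s in nhds t. exp (- 1 / s) / s ^ k = flat k s"
    using eventually_nhds_in_open [of "{0<..}" t] greater
    by (auto elim!: eventually_mono simp: flat_def)
  ultimately show ?thesis by (subst (asm) DERIV_cong_ev) auto
qed

text \<open>The algebra generated by the flat functions of affine arguments. It is closed under
  differentiation, so all iterated derivatives of its members exist, and no formula for a higher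
  derivative of a cutoff function has to be written down.\<close>

inductive_set flat_algebra :: "(real \<Rightarrow> real) set" where
  flat: "(\<lambda>x. flat k (m * x + c)) \<in> flat_algebra"
| const: "(\<lambda>x. r) \<in> flat_algebra"
| add: "\<lbrakk>f \<in> flat_algebra; g \<in> flat_algebra\<rbrakk> \<Longrightarrow> (\<lambda>x. f x + g x) \<in> flat_algebra"
| mult: "\<lbrakk>f \<in> flat_algebra; g \<in> flat_algebra\<rbrakk> \<Longrightarrow> (\<lambda>x. f x * g x) \<in> flat_algebra"

lemma flat_algebra_derivative:
  assumes "f \<in> flat_algebra"
  shows "\<exists>f'\<in>flat_algebra. \<forall>x. (f has_real_derivative f' x) (at x)"
  using assms
proof induction
  case (flat k m c)
  have "((\<lambda>x. flat k (m * x + c)) has_real_derivative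
      (m * flat (k + 2) (m * x + c) + (- real k * m) * flat (Suc k) (m * x + c))) (at x)" for x
    by (rule DERIV_cong [OF DERIV_chain2 [where f = "flat k" and g = "\<lambda>x. m * x + c" and Db = m,
            OF flat_has_real_derivative]])
      (auto intro!: derivative_eq_intros simp: algebra_simps)
  moreover have "(\<lambda>x. m * flat (k + 2) (m * x + c) + (- real k * m) * flat (Suc k) (m * x + c))
      \<in> flat_algebra"
    by (intro flat_algebra.intros)
  ultimately show ?case
    by (intro bexI [of _ "\<lambda>x. m * flat (k + 2) (m * x + c) + (- real k * m) * flat (Suc k) (m * x + c)"])
      auto
next
  case (const r)
  then show ?case by (intro bexI [of _ "\<lambda>x. 0"]) (auto intro: flat_algebra.intros)
next
  case (add f g)
  then obtain f' g' where "f' \<in> flat_algebra" "g' \<in> flat_algebra"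
    "\<And>x. (f has_real_derivative f' x) (at x)" "\<And>x. (g has_real_derivative g' x) (at x)"
    by blast
  then show ?case
    by (intro bexI [of _ "\<lambda>x. f' x + g' x"]) (auto intro!: flat_algebra.intros derivative_intros)
next
  case (mult f g)
  then obtain f' g' where "f' \<in> flat_algebra" "g' \<in> flat_algebra"
    "\<And>x. (f has_real_derivative f' x) (at x)" "\<And>x. (g has_real_derivative g' x) (at x)"
    by blast
  with mult.hyps show ?case
    by (intro bexI [of _ "\<lambda>x. f' x * g x + g' x * f x"])
      (auto intro!: flat_algebra.intros derivative_eq_intros)
qed

lemma flat_algebra_smooth:
  assumes "f \<in> flat_algebra"
  shows "(deriv ^^ n) f differentiable (at x)"
proof -
  have "(deriv ^^ n) f \<in> flat_algebra"
  proof (induction n)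
    case (Suc n)
    then obtain f' where "f' \<in> flat_algebra" "\<forall>x. ((deriv ^^ n) f has_real_derivative f' x) (at x)"
      using flat_algebra_derivative by blast
    then have "deriv ((deriv ^^ n) f) = f'" by (auto intro: DERIV_imp_deriv)
    with \<open>f' \<in> _\<close> show ?case by simp
  qed (use assms in simp)
  then show ?thesis
    using flat_algebra_derivative real_differentiable_def by blast
qed

text \<open>The shift by \<open>1\<close> keeps the support away from \<open>a\<close> and \<open>b\<close>.\<close>

definition plateau :: "real \<Rightarrow> real \<Rightarrow> nat \<Rightarrow> real \<Rightarrow> real"
  where "plateau a b n x =
    flat 0 (real (Suc n) * (x - a) - 1) * flat 0 (real (Suc n) * (b - x) - 1)"

lemma plateau_test_function:
  assumes "0 \<le> a" "b \<le> 1"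
  shows "plateau a b n \<in> test_functions"
proof -
  have "plateau a b n = (\<lambda>x. flat 0 (real (Suc n) * x + (real (Suc n) * - a - 1)) *
      flat 0 (- real (Suc n) * x + (real (Suc n) * b - 1)))"
    by (auto simp: plateau_def fun_eq_iff algebra_simps)
  then have "plateau a b n \<in> flat_algebra"
    by (simp only: flat_algebra.intros)
  moreover have "plateau a b n x = 0" if "x \<notin> {a + 1 / real (Suc n)..b - 1 / real (Suc n)}" for x
  proof -
    have "real (Suc n) * (x - a) \<le> 1 \<or> real (Suc n) * (b - x) \<le> 1"
      using that by (auto simp: not_le field_simps simp del: of_nat_Suc)
    then show ?thesis by (auto simp: plateau_def flat_def simp del: of_nat_Suc)
  qed
  \<comment> \<open>For small \<open>n\<close> this interval may be empty; the function is then
    identically zero and still a test function.\<close>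
  moreover have "{a + 1 / real (Suc n)..b - 1 / real (Suc n)} \<subseteq> \<Omega>"
  proof -
    have "0 < 1 / real (Suc n)" by simp
    with assms show ?thesis
      by (smt (verit) atLeastAtMost_iff greaterThanLessThan_iff subsetI)
  qed
  ultimately show ?thesis
    by (auto simp: test_functions_def flat_algebra_smooth simp del: of_nat_Suc
        intro!: exI [of _ "{a + 1 / real (Suc n)..b - 1 / real (Suc n)}"])
qed

lemma plateau_bound: "\<bar>plateau a b n x\<bar> \<le> 1"
proof -
  have "\<bar>flat 0 t\<bar> \<le> 1" for t by (auto simp: flat_def)
  then show ?thesis by (simp add: plateau_def abs_mult mult_le_one)
qed

text \<open>Inside the interval both arguments tend to infinity, where \<open>flat 0\<close> tends
  to 1. Outside, one argument is at most -1 for every \<open>n\<close>, so the product is exactly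
  zero.\<close>

lemma plateau_tendsto: "(\<lambda>n. plateau a b n x) \<longlonglongrightarrow> indicator {a<..<b} x"
proof (cases "x \<in> {a<..<b}")
  case True
  have lim: "(\<lambda>n. flat 0 (real (Suc n) * t - 1)) \<longlonglongrightarrow> 1" if "t > 0" for t
  proof -
    have top: "filterlim (\<lambda>n. real (Suc n) * t - 1) at_top sequentially"
      unfolding filterlim_at_top
    proof
      fix Z
      show "\<forall>\<^sub>F n in sequentially. Z \<le> real (Suc n) * t - 1"
        using eventually_ge_at_top [of "nat \<lceil>(Z + 1) / t\<rceil>"]
      proof eventually_elim
        case (elim n)
        then have "(Z + 1) / t \<le> real n" by linarith
        then have "Z + 1 \<le> real n * t" using that by (simp add: field_simps)
        then show ?case using that by (simp add: algebra_simps)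
      qed
    qed
    have "(\<lambda>n. exp (- inverse (real (Suc n) * t - 1))) \<longlonglongrightarrow> exp (- 0)"
      by (intro tendsto_intros tendsto_compose_filtermap filterlim_compose [OF tendsto_inverse_0_at_top top]
          tendsto_inverse_0_at_top top)
    moreover have "\<forall>\<^sub>F n in sequentially.
        exp (- inverse (real (Suc n) * t - 1)) = flat 0 (real (Suc n) * t - 1)"
      using filterlim_at_top_dense [THEN iffD1, OF top, rule_format, of 0]
      by eventually_elim (simp add: flat_def divide_inverse)
    ultimately show ?thesis using Lim_transform_eventually by fastforce
  qed
  have "(\<lambda>n. plateau a b n x) \<longlonglongrightarrow> 1 * 1"
    unfolding plateau_def using True by (intro tendsto_mult lim) auto
  then show ?thesis using True by simp
next
  case False
  then have "plateau a b n x = 0" for n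
  proof -
    have "real (Suc n) * (x - a) \<le> 0 \<or> real (Suc n) * (b - x) \<le> 0"
      using False by (auto simp: mult_le_0_iff simp del: of_nat_Suc)
    then show ?thesis by (auto simp: plateau_def flat_def simp del: of_nat_Suc)
  qed
  then show ?thesis using False by simp
qed

lemma test_function_differentiable:
  assumes "\<phi> \<in> test_functions"
  shows "(\<phi> has_real_derivative deriv \<phi> x) (at x)" "(deriv \<phi> has_real_derivative deriv (deriv \<phi>) x) (at x)"
proof -
  have "(deriv ^^ n) \<phi> differentiable (at x)" for n using assms by (auto simp: test_functions_def)
  from this [of 0] this [of 1]
  show "(\<phi> has_real_derivative deriv \<phi> x) (at x)" "(deriv \<phi> has_real_derivative deriv (deriv \<phi>) x) (at x)"
    by (auto simp: DERIV_deriv_iff_real_differentiable)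
qed

section \<open>Square-integrable functions on the unit interval\<close>

lemma finite_measure_Omega: "finite_measure (lebesgue_on \<Omega>)"
  by (rule finite_measureI) (simp add: emeasure_restrict_space)

lemma continuous_on_borel_measurable_Omega:
  "continuous_on \<Omega> f \<Longrightarrow> f \<in> borel_measurable (lebesgue_on \<Omega>)" for f :: "real \<Rightarrow> real"
  by (rule continuous_imp_measurable_on_sets_lebesgue) auto

lemma integrable_bounded_Omega:
  fixes f :: "real \<Rightarrow> real"
  assumes "f \<in> borel_measurable (lebesgue_on \<Omega>)" "\<And>x. x \<in> \<Omega> \<Longrightarrow> \<bar>f x\<bar> \<le> B"
  shows "integrable (lebesgue_on \<Omega>) f"
  using assms by (intro finite_measure.integrable_const_bound [OF finite_measure_Omega, of _ B]) auto

lemma continuous_on_L2: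
  assumes "continuous_on {0..1} u" shows "u \<in> L2"
proof -
  have "compact (u ` {0..1})" using assms by (intro compact_continuous_image) auto
  then obtain B where "\<And>x. x \<in> {0..1} \<Longrightarrow> \<bar>u x\<bar> \<le> B"
    using that by (fastforce dest!: compact_imp_bounded simp: bounded_iff)
  then have "\<bar>(u x)\<^sup>2\<bar> \<le> B\<^sup>2" if "x \<in> \<Omega>" for x
    using power_mono [of "\<bar>u x\<bar>" B 2] that by simp
  moreover have "u \<in> borel_measurable (lebesgue_on \<Omega>)"
    using assms by (intro continuous_on_borel_measurable_Omega) (auto elim: continuous_on_subset)
  ultimately show ?thesis
    unfolding L2_def by (auto intro!: integrable_bounded_Omega [where B = "B\<^sup>2"])
qed

lemma L2_integrable_mult:
  assumes "u \<in> L2" "v \<in> L2"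
  shows "integrable (lebesgue_on \<Omega>) (\<lambda>x. u x * v x)"
proof (rule Bochner_Integration.integrable_bound)
  show "integrable (lebesgue_on \<Omega>) (\<lambda>x. (u x)\<^sup>2 + (v x)\<^sup>2)"
    using assms by (auto simp: L2_def)
  show "(\<lambda>x. u x * v x) \<in> borel_measurable (lebesgue_on \<Omega>)"
    using assms by (auto simp: L2_def)
  have "norm (u x * v x) \<le> norm ((u x)\<^sup>2 + (v x)\<^sup>2)" for x
  proof -
    have "0 \<le> (\<bar>u x\<bar> - \<bar>v x\<bar>)\<^sup>2" "0 \<le> \<bar>u x\<bar> * \<bar>v x\<bar>" by auto
    then have "\<bar>u x\<bar> * \<bar>v x\<bar> \<le> (u x)\<^sup>2 + (v x)\<^sup>2"
      unfolding power2_diff power2_abs by linarith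
    then show ?thesis by (simp add: abs_mult)
  qed
  then show "AE x in lebesgue_on \<Omega>. norm (u x * v x) \<le> norm ((u x)\<^sup>2 + (v x)\<^sup>2)" by simp
qed

lemma L2_add: "\<lbrakk>u \<in> L2; v \<in> L2\<rbrakk> \<Longrightarrow> (\<lambda>x. u x + v x) \<in> L2"
  using L2_integrable_mult [of u v] by (auto simp: L2_def power2_sum mult.assoc)

lemma L2_scale: "u \<in> L2 \<Longrightarrow> (\<lambda>x. c * u x) \<in> L2"
  by (auto simp: L2_def power_mult_distrib)

lemma L2_integrable:
  assumes "u \<in> L2" shows "integrable (lebesgue_on \<Omega>) u"
proof -
  have "(\<lambda>x. 1) \<in> L2" by (rule continuous_on_L2) auto
  from L2_integrable_mult [OF assms this] show ?thesis by simp
qed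

lemma L2_inner_add_left:
  "\<lbrakk>w \<in> L2; u \<in> L2; v \<in> L2\<rbrakk> \<Longrightarrow> L2_inner (\<lambda>x. u x + v x) w = L2_inner u w + L2_inner v w"
  by (simp add: L2_inner_def distrib_right L2_integrable_mult)

lemma L2_inner_commute: "L2_inner u v = L2_inner v u"
  by (simp add: L2_inner_def mult.commute)

lemma L2_inner_scale_right: "L2_inner u (\<lambda>x. c * v x) = c * L2_inner u v"
  by (simp add: L2_inner_def mult.left_commute [of _ c])

text \<open>A Dynkin system argument: open intervals are stable under intersection and generate the
  Borel sets, and the Borel sets over which \<open>h\<close> integrates to zero are closed under
  complements and countable disjoint unions. Lebesgue sets differ from Borel sets by null sets
  only.\<close>

lemma AE_zero_if_interval_integrals_zero:
  fixes h :: "real \<Rightarrow> real"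
  assumes h: "integrable (lebesgue_on \<Omega>) h"
    and zero: "\<And>a b. \<lbrakk>0 \<le> a; a \<le> b; b \<le> 1\<rbrakk> \<Longrightarrow> (\<integral>x. indicator {a<..<b} x * h x \<partial>lebesgue_on \<Omega>) = 0"
  shows "AE x in lebesgue_on \<Omega>. h x = 0"
proof -
  have borel_lebesgue: "A \<inter> \<Omega> \<in> sets (lebesgue_on \<Omega>)" if "A \<in> sets borel" for A
    using that by (auto simp: sets_restrict_space_iff)
  have ind_int: "integrable (lebesgue_on \<Omega>) (\<lambda>x. indicator A x * h x)" if "A \<in> sets borel" for A
  proof -
    have "integrable (lebesgue_on \<Omega>) (\<lambda>x. h x * indicator (A \<inter> \<Omega>) x)"
      by (rule integrable_real_mult_indicator [OF borel_lebesgue [OF that] h])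
    then show ?thesis
      by (rule Bochner_Integration.integrable_cong [THEN iffD1, rotated 2]) (auto simp: indicator_def)
  qed
  \<comment> \<open>The complement step subtracts from the integral over the whole interval, which
    must itself be zero.\<close>
  have full: "(\<integral>x. h x \<partial>lebesgue_on \<Omega>) = 0"
  proof -
    have "(\<integral>x. h x \<partial>lebesgue_on \<Omega>) = (\<integral>x. indicator \<Omega> x * h x \<partial>lebesgue_on \<Omega>)"
      by (rule Bochner_Integration.integral_cong) simp_all
    then show ?thesis using zero [of 0 1] by simp
  qed
  have borel: "(\<integral>x. indicator A x * h x \<partial>lebesgue_on \<Omega>) = 0" if "A \<in> sets borel" for A
  proof -
    have "Int_stable (range (\<lambda>(a, b). box a b :: real set))"
      by (auto simp: Int_stable_def)
    moreover have "range (\<lambda>(a, b). box a b :: real set) \<subseteq> Pow UNIV" by simp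
    moreover have "A \<in> sigma_sets UNIV (range (\<lambda>(a, b). box a b :: real set))"
      using that by (simp add: borel_eq_box)
    ultimately show ?thesis
    proof (induction rule: sigma_sets_induct_disjoint)
      case (basic A)
      then obtain a b where A: "A = {a<..<b}" by auto
      let ?a = "max 0 a" and ?b = "min 1 b"
      have eq: "indicator A x = (indicator {?a<..<?b} x :: real)" if "x \<in> \<Omega>" for x
        using that by (auto simp: A indicator_def)
      have "(\<integral>x. indicator A x * h x \<partial>lebesgue_on \<Omega>) =
          (\<integral>x. indicator {?a<..<?b} x * h x \<partial>lebesgue_on \<Omega>)"
        by (rule Bochner_Integration.integral_cong) (simp_all add: eq)
      also have "\<dots> = 0"
        by (cases "?a \<le> ?b") (auto intro: zero simp: not_le)
      finally show ?case .
    next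
      case (compl A)
      then have A: "A \<in> sets borel" by (simp add: borel_eq_box)
      have "(\<integral>x. indicator (UNIV - A) x * h x \<partial>lebesgue_on \<Omega>) =
          (\<integral>x. h x - indicator A x * h x \<partial>lebesgue_on \<Omega>)"
        by (rule Bochner_Integration.integral_cong) (auto simp: indicator_def)
      with compl show ?case by (simp add: h ind_int [OF A] full)
    next
      case (union A)
      then have A: "A i \<in> sets borel" for i by (auto simp: borel_eq_box)
      have "(\<lambda>i. \<integral>x. indicator (A i) x * h x \<partial>lebesgue_on \<Omega>) sums
          (\<integral>x. indicator (\<Union>i. A i) x * h x \<partial>lebesgue_on \<Omega>)"
      proof -
        have "(\<lambda>n. \<integral>x. indicator (\<Union>i<n. A i) x * h x \<partial>lebesgue_on \<Omega>) \<longlonglongrightarrow>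
            (\<integral>x. indicator (\<Union>i. A i) x * h x \<partial>lebesgue_on \<Omega>)"
        \<comment> \<open>Countable additivity: the finite partial unions increase to the full
          union, and \<bar>h\<bar> dominates.\<close>
        proof (rule integral_dominated_convergence [where w = "\<lambda>x. \<bar>h x\<bar>"])
          show "AE x in lebesgue_on \<Omega>.
              (\<lambda>n. indicator (\<Union>i<n. A i) x * h x) \<longlonglongrightarrow> indicator (\<Union>i. A i) x * h x"
            by (intro AE_I2 tendsto_mult_right LIMSEQ_indicator_UN)
          show "AE x in lebesgue_on \<Omega>. norm (indicator (\<Union>i<n. A i) x * h x) \<le> \<bar>h x\<bar>" for n
            by (auto simp: indicator_def)
        qed (use h A in \<open>auto intro!: borel_measurable_integrable [OF ind_int]\<close>)
        moreover have "(\<integral>x. indicator (\<Union>i<n. A i) x * h x \<partial>lebesgue_on \<Omega>) =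
            (\<Sum>i<n. \<integral>x. indicator (A i) x * h x \<partial>lebesgue_on \<Omega>)" for n
        proof -
          have "disjoint_family_on A {..<n}" using union by (auto simp: disjoint_family_on_def)
          then show ?thesis
            by (subst Bochner_Integration.integral_sum [symmetric])
              (auto intro: ind_int A simp: indicator_UN_disjoint sum_distrib_right)
        qed
        ultimately show ?thesis by (simp add: sums_def)
      qed
      then show ?case using union by (simp add: sums_iff)
    qed simp
  qed
  interpret finite_measure "lebesgue_on \<Omega>" by (rule finite_measure_Omega)
  show ?thesis
  proof (rule density_zero [OF h])
    fix A assume "A \<in> sets (lebesgue_on \<Omega>)"
    then have "A \<in> sets lebesgue" by (simp add: sets_restrict_space_iff)
    \<comment> \<open>A Lebesgue set is a Borel set \<open>S\<close> together with a part of a Borel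
      null set \<open>N'\<close>, so the two indicators agree off \<open>N'\<close>.\<close>
    then obtain S N N' where A: "A = S \<union> N" "N \<subseteq> N'" "N' \<in> null_sets lborel" "S \<in> sets lborel"
      by (rule sets_completionE)
    have "AE x in lebesgue. x \<notin> N'" using A(3) by (auto intro!: AE_not_in null_sets_completionI)
    then have "AE x in lebesgue_on \<Omega>. indicator A x * h x = indicator S x * h x"
      unfolding AE_restrict_space_iff [of \<Omega> lebesgue, simplified]
      by (rule AE_mp) (use A in \<open>auto simp: indicator_def\<close>)
    then have "(\<integral>x. indicator A x * h x \<partial>lebesgue_on \<Omega>) = (\<integral>x. indicator S x * h x \<partial>lebesgue_on \<Omega>)"
      using A h \<open>A \<in> sets (lebesgue_on \<Omega>)\<close> ind_int [of S]
      by (intro integral_cong_AE) auto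
    also have "\<dots> = 0" using A borel by auto
    finally show "set_lebesgue_integral (lebesgue_on \<Omega>) A h = 0"
      by (simp add: set_lebesgue_integral_def)
  qed
qed

text \<open>The plateau functions are test functions bounded by 1 that converge to the indicator of
  an interval; dominated convergence with majorant \<bar>h\<bar> passes orthogonality on to
  intervals.\<close>

lemma fundamental_lemma_calculus_of_variations:
  assumes h: "h \<in> L2" and zero: "\<And>\<phi>. \<phi> \<in> test_functions \<Longrightarrow> L2_inner h \<phi> = 0"
  shows "AE x in lebesgue_on \<Omega>. h x = 0"
proof (rule AE_zero_if_interval_integrals_zero)
  show hi: "integrable (lebesgue_on \<Omega>) h" by (rule L2_integrable [OF h])
  fix a b :: real assume ab: "0 \<le> a" "a \<le> b" "b \<le> 1"
  have "(\<lambda>n. \<integral>x. plateau a b n x * h x \<partial>lebesgue_on \<Omega>)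
      \<longlonglongrightarrow> (\<integral>x. indicator {a<..<b} x * h x \<partial>lebesgue_on \<Omega>)"
  proof (rule integral_dominated_convergence [where w = "\<lambda>x. \<bar>h x\<bar>"])
    have "plateau a b n \<in> borel_measurable (lebesgue_on \<Omega>)" for n
      using test_function_differentiable(1) [OF plateau_test_function [OF ab(1,3)]]
      by (intro continuous_on_borel_measurable_Omega DERIV_continuous_on) (blast intro: DERIV_subset)
    then show "(\<lambda>x. plateau a b n x * h x) \<in> borel_measurable (lebesgue_on \<Omega>)" for n
      using h by (auto simp: L2_def)
    have "{a<..<b} \<subseteq> \<Omega>" using ab by auto
    then have "{a<..<b} \<in> sets (lebesgue_on \<Omega>)" by (simp add: sets_restrict_space_iff)
    then show "(\<lambda>x. indicator {a<..<b} x * h x) \<in> borel_measurable (lebesgue_on \<Omega>)"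
      using h by (auto simp: L2_def)
    show "AE x in lebesgue_on \<Omega>. (\<lambda>n. plateau a b n x * h x) \<longlonglongrightarrow> indicator {a<..<b} x * h x"
      by (auto intro!: AE_I2 tendsto_mult plateau_tendsto)
    show "AE x in lebesgue_on \<Omega>. norm (plateau a b n x * h x) \<le> \<bar>h x\<bar>" for n
      using plateau_bound by (auto intro!: AE_I2 mult_left_le_one_le simp: abs_mult)
  qed (use hi in auto)
  moreover have "(\<integral>x. plateau a b n x * h x \<partial>lebesgue_on \<Omega>) = 0" for n
    using zero [OF plateau_test_function [OF ab(1,3)]] by (simp add: L2_inner_def mult.commute)
  ultimately show "(\<integral>x. indicator {a<..<b} x * h x \<partial>lebesgue_on \<Omega>) = 0"
    by (simp add: LIMSEQ_const_iff)
qed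

section \<open>Weak derivatives and the strong form of the local problem\<close>

lemma weak_deriv_unique:
  assumes "has_weak_deriv u g" "has_weak_deriv u g'"
  shows "AE x in lebesgue_on \<Omega>. g x = g' x"
proof -
  have gg: "g \<in> L2" "(\<lambda>x. (- 1) * g' x) \<in> L2" "g' \<in> L2"
    using assms L2_scale [of g' "- 1"] by (auto simp: has_weak_deriv_def)
  have "AE x in lebesgue_on \<Omega>. g x + (- 1) * g' x = 0"
  proof (rule fundamental_lemma_calculus_of_variations [OF L2_add [OF gg(1,2)]])
    fix \<phi> assume \<phi>: "\<phi> \<in> test_functions"
    then have "continuous_on {0..1} \<phi>"
      using test_function_differentiable(1)
      by (intro DERIV_continuous_on) (blast intro: DERIV_subset)
    then have "\<phi> \<in> L2" by (rule continuous_on_L2)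
    then have "L2_inner (\<lambda>x. g x + (- 1) * g' x) \<phi> = L2_inner g \<phi> - L2_inner g' \<phi>"
      using L2_inner_add_left [OF _ gg(1,2)] L2_inner_scale_right [of \<phi> "-1" g']
      by (simp add: L2_inner_commute)
    also have "\<dots> = 0" using assms \<phi> by (auto simp: has_weak_deriv_def)
    finally show "L2_inner (\<lambda>x. g x + (- 1) * g' x) \<phi> = 0" .
  qed
  then show ?thesis by eventually_elim simp
qed

lemma has_weak_deriv_weak_deriv: "u \<in> H1 \<Longrightarrow> has_weak_deriv u (weak_deriv u)"
  unfolding H1_def weak_deriv_def by (simp add: someI_ex)

text \<open>For \<open>F\<close> a product of two test functions this is the integration by parts
  that makes the classical derivative a weak one.\<close>

lemma integral_derivative_eq_0:
  fixes F F' :: "real \<Rightarrow> real"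
  assumes F: "\<And>x. (F has_real_derivative F' x) (at x)" and F': "continuous_on UNIV F'"
    and "F 0 = 0" "F 1 = 0"
  shows "(\<integral>x. F' x \<partial>lebesgue_on \<Omega>) = 0"
proof -
  have "(F' has_integral (F 1 - F 0)) {0..1}"
    using F by (intro fundamental_theorem_of_calculus)
      (auto simp flip: has_real_derivative_iff_has_vector_derivative intro: DERIV_subset)
  then have "integral {0<..<1} F' = 0"
    using assms by (simp add: integral_unique has_integral_Icc_iff_Ioo)
  moreover have "integrable (lebesgue_on \<Omega>) F'"
    by (rule L2_integrable [OF continuous_on_L2]) (rule continuous_on_subset [OF F'], auto)
  ultimately show ?thesis by (simp add: lebesgue_integral_eq_integral)
qed

lemma test_function_has_weak_deriv:
  assumes \<phi>: "\<phi> \<in> test_functions" shows "has_weak_deriv \<phi> (deriv \<phi>)"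
proof -
  have cont: "continuous_on S \<psi>" "continuous_on S (deriv \<psi>)" if "\<psi> \<in> test_functions" for \<psi> S
    using test_function_differentiable [OF that]
    by (meson DERIV_isCont continuous_at_imp_continuous_on)+
  have "L2_inner \<phi> (deriv \<psi>) = - L2_inner (deriv \<phi>) \<psi>" if \<psi>: "\<psi> \<in> test_functions" for \<psi>
  proof -
    have "\<phi> 0 = 0" "\<phi> 1 = 0" using \<phi> by (auto simp: test_functions_def)
    then have "(\<integral>x. deriv \<phi> x * \<psi> x + deriv \<psi> x * \<phi> x \<partial>lebesgue_on \<Omega>) = 0"
      by (intro integral_derivative_eq_0 [of "\<lambda>x. \<phi> x * \<psi> x"] DERIV_mult continuous_intros
          test_function_differentiable cont \<phi> \<psi>) auto
    also have "(\<integral>x. deriv \<phi> x * \<psi> x + deriv \<psi> x * \<phi> x \<partial>lebesgue_on \<Omega>) =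
        L2_inner (deriv \<phi>) \<psi> + L2_inner (deriv \<psi>) \<phi>"
      unfolding L2_inner_def
      by (intro Bochner_Integration.integral_add L2_integrable_mult continuous_on_L2 cont \<phi> \<psi>)
    finally show ?thesis by (simp add: L2_inner_commute)
  qed
  then show ?thesis
    using cont [OF \<phi>] by (auto simp: has_weak_deriv_def intro: continuous_on_L2)
qed

lemma L2_inner_cong_AE:
  assumes "AE x in lebesgue_on \<Omega>. u x = u' x" "u \<in> L2" "u' \<in> L2" "v \<in> L2"
  shows "L2_inner u v = L2_inner u' v"
  unfolding L2_inner_def
  by (rule integral_cong_AE) (use assms in \<open>auto simp: L2_def\<close>)

text \<open>A test function is its own approximation. As \<open>weak_deriv\<close> picks an
  arbitrary representative, that the zero function has \<open>H1_norm\<close> zero rests on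
  uniqueness almost everywhere.\<close>

lemma test_functions_subset_H1_0: "test_functions \<subseteq> H1_0"
proof
  fix \<phi> assume \<phi>: "\<phi> \<in> test_functions"
  have "(\<lambda>x. 0) \<in> L2" by (rule continuous_on_L2) auto
  then have "has_weak_deriv (\<lambda>x. 0) (\<lambda>x. 0)" by (auto simp: has_weak_deriv_def L2_inner_def)
  moreover from this have "has_weak_deriv (\<lambda>x. 0) (weak_deriv (\<lambda>x. 0))"
    by (intro has_weak_deriv_weak_deriv) (unfold H1_def, blast)
  ultimately have 0: "AE x in lebesgue_on \<Omega>. weak_deriv (\<lambda>x. 0) x = 0"
    by (rule weak_deriv_unique [rotated])
  have "L2_inner (weak_deriv (\<lambda>x. 0)) (weak_deriv (\<lambda>x. 0)) = 0"
    unfolding L2_inner_def by (rule integral_eq_zero_AE) (use 0 in auto)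
  then have "H1_norm (\<lambda>x. \<phi> x - \<phi> x) = 0"
    by (simp add: H1_norm_def L2_norm_def L2_inner_def)
  then have "\<exists>\<psi>\<in>test_functions. H1_norm (\<lambda>x. \<phi> x - \<psi> x) < \<epsilon>" if "\<epsilon> > 0" for \<epsilon>
    using \<phi> that by (intro bexI [of _ \<phi>]) auto
  then show "\<phi> \<in> H1_0"
    using test_function_has_weak_deriv [OF \<phi>] by (auto simp: H1_0_def H1_def)
qed

text \<open>Testing with smooth functions and moving the derivative back onto u' shows that f + u''
  is orthogonal to all of them, hence zero almost everywhere. The identity then holds against every
  square-integrable \<open>w\<close>, in particular against finite element functions, without
  placing them in \<open>H1_0\<close>.\<close>

lemma local_weak_solution_strong:
  assumes u: "u \<in> H2" "local_weak_solution f u" and f: "f \<in> L2" and w: "w \<in> L2"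
  shows "L2_inner f w = B_local u w"
proof -
  let ?g = "weak_deriv u" and ?g2 = "\<lambda>x. - weak_deriv (weak_deriv u) x"
  have g: "has_weak_deriv ?g (weak_deriv ?g)"
    using u by (auto simp: H2_def intro: has_weak_deriv_weak_deriv)
  have g2: "?g2 \<in> L2" using g L2_scale [of _ "- 1"] by (auto simp: has_weak_deriv_def)
  have "AE x in lebesgue_on \<Omega>. f x + (- 1) * ?g2 x = 0"
  proof (rule fundamental_lemma_calculus_of_variations [OF L2_add [OF f L2_scale [OF g2]]])
    fix \<phi> assume \<phi>: "\<phi> \<in> test_functions"
    then have wd: "has_weak_deriv \<phi> (weak_deriv \<phi>)" "has_weak_deriv \<phi> (deriv \<phi>)"
      using test_functions_subset_H1_0 test_function_has_weak_deriv
      by (auto intro!: has_weak_deriv_weak_deriv simp: H1_0_def)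
    have \<phi>2: "\<phi> \<in> L2" "?g \<in> L2" "deriv \<phi> \<in> L2" "weak_deriv \<phi> \<in> L2"
      using g wd by (auto simp: has_weak_deriv_def)
    have "L2_inner f \<phi> = L2_inner (weak_deriv \<phi>) ?g"
      using u \<phi> test_functions_subset_H1_0 by (auto simp: local_weak_solution_def L2_inner_commute)
    \<comment> \<open>The weak formulation speaks of the chosen representative
      \<open>weak_deriv \<phi>\<close>, whereas the weak derivative of u' is defined by testing with
      \<open>deriv \<phi>\<close>.\<close>
    also have "\<dots> = L2_inner (deriv \<phi>) ?g"
      by (rule L2_inner_cong_AE [OF weak_deriv_unique [OF wd]]) (use \<phi>2 in auto)
    also have "\<dots> = - L2_inner (weak_deriv ?g) \<phi>"
      using g \<phi> by (auto simp: has_weak_deriv_def L2_inner_commute)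
    finally have "L2_inner f \<phi> = - L2_inner (weak_deriv ?g) \<phi>" .
    moreover have "L2_inner (\<lambda>x. f x + (- 1) * ?g2 x) \<phi> = L2_inner f \<phi> + L2_inner (weak_deriv ?g) \<phi>"
      using L2_inner_add_left [OF \<phi>2(1) f L2_scale [OF g2, of "- 1"]] by simp
    ultimately show "L2_inner (\<lambda>x. f x + (- 1) * ?g2 x) \<phi> = 0" by simp
  qed
  then have "AE x in lebesgue_on \<Omega>. f x = ?g2 x" by eventually_elim simp
  then show ?thesis
    unfolding B_local_def by (rule L2_inner_cong_AE) (use f g2 w in auto)
qed

subsection \<open>The nonlocal form as a symmetric bilinear form\<close>

text \<open>Evaluation at the minimizer t = -b/c, or far out on a line if c = 0. Both Cauchy-Schwarz
  inequalities below rest on it.\<close>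

lemma nonneg_quadratic_discriminant:
  fixes a b c :: real
  assumes "\<And>t. 0 \<le> a + 2 * t * b + t\<^sup>2 * c" "0 \<le> c"
  shows "b\<^sup>2 \<le> a * c"
proof (cases "c = 0")
  case True
  have "b = 0"
  proof (rule ccontr)
    assume "b \<noteq> 0"
    \<comment> \<open>At this point the affine function has the value -1.\<close>
    with assms(1) [of "- (a + 1) / (2 * b)"] True show False by (simp add: field_simps)
  qed
  then show ?thesis using True by simp
next
  case False
  have "0 \<le> (a + 2 * (- b / c) * b + (- b / c)\<^sup>2 * c) * c"
    by (rule mult_nonneg_nonneg [OF assms])
  also have "\<dots> = a * c - b\<^sup>2" using False by (simp add: field_simps power2_eq_square)
  finally show ?thesis by simp
qed

text \<open>The odd antiderivative \<open>F\<close> is continuous across the singularity at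
  \<open>x\<close> because a + 1 > 0, so \<open>x\<close> can be excluded as a single exceptional
  point.\<close>

lemma has_integral_abs_powr:
  fixes a x r :: real
  assumes "a > -1" "r > 0"
  shows "((\<lambda>y. \<bar>x - y\<bar> powr a) has_integral (2 * r powr (a + 1) / (a + 1))) {x - r..x + r}"
proof -
  define F where "F y = sgn (y - x) * \<bar>y - x\<bar> powr (a + 1) / (a + 1)" for y
  have "((\<lambda>y. \<bar>x - y\<bar> powr a) has_integral (F (x + r) - F (x - r))) {x - r..x + r}"
  proof (rule fundamental_theorem_of_calculus_interior_strong [of "{x}"])
    have eq: "F = (\<lambda>y. (max 0 (y - x) powr (a + 1) - max 0 (x - y) powr (a + 1)) / (a + 1))"
      by (auto simp: F_def fun_eq_iff sgn_if max_def)
    show "continuous_on {x - r..x + r} F"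
      unfolding eq using assms by (intro continuous_intros continuous_on_powr') auto
    fix y assume y: "y \<in> {x - r<..<x + r} - {x}"
    show "(F has_vector_derivative \<bar>x - y\<bar> powr a) (at y)"
    proof (cases "y > x")
      case True
      have "((\<lambda>y. (y - x) powr (a + 1) / (a + 1)) has_real_derivative \<bar>x - y\<bar> powr a) (at y)"
        using True assms by (auto intro!: derivative_eq_intros)
      then have "(F has_real_derivative \<bar>x - y\<bar> powr a) (at y)"
        by (rule has_field_derivative_transform_within_open [where S = "{x<..}"])
          (use True in \<open>auto simp: F_def\<close>)
      then show ?thesis by (simp add: has_real_derivative_iff_has_vector_derivative)
    next
      case False
      then have "y < x" using y by auto
      have "((\<lambda>y. - ((x - y) powr (a + 1) / (a + 1))) has_real_derivative \<bar>x - y\<bar> powr a) (at y)"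
        using \<open>y < x\<close> assms by (auto intro!: derivative_eq_intros)
      then have "(F has_real_derivative \<bar>x - y\<bar> powr a) (at y)"
        by (rule has_field_derivative_transform_within_open [where S = "{..<x}"])
          (use \<open>y < x\<close> in \<open>auto simp: F_def\<close>)
      then show ?thesis by (simp add: has_real_derivative_iff_has_vector_derivative)
    qed
  qed (use assms in auto)
  moreover have "F (x + r) - F (x - r) = 2 * r powr (a + 1) / (a + 1)"
    using assms by (simp add: F_def)
  ultimately show ?thesis by simp
qed

text \<open>The space, the form and its norm are set up for any measurable positive horizon; its
  regularity and its distance to the boundary enter in \<open>nonlocal_form_C1\<close>.\<close>

locale nonlocal_form =
  fixes \<beta> :: real and q lam :: "real \<Rightarrow> real" and \<delta> :: real
  assumes beta: "0 < \<beta>" "\<beta> < 3"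
    and eta_measurable: "eta q lam \<delta> \<in> borel_measurable (lebesgue_on \<Omega>)"
    and eta_pos: "x \<in> \<Omega> \<Longrightarrow> 0 < eta q lam \<delta> x"
begin

abbreviation "k u v x y \<equiv> nl_integrand \<beta> q lam \<delta> u v x y"
abbreviation "B u v \<equiv> B_nl \<beta> q lam \<delta> u v"
abbreviation "W \<equiv> W_space \<beta> q lam \<delta>"
abbreviation "P \<equiv> lebesgue_on \<Omega> \<Otimes>\<^sub>M lebesgue_on \<Omega>"

sublocale pair_sigma_finite "lebesgue_on \<Omega>" "lebesgue_on \<Omega>"
  by (intro pair_sigma_finite.intro finite_measure.axioms finite_measure_Omega)

lemma kernel_nonneg: "0 \<le> k u u x y"
  using beta by (auto simp: nl_integrand_def weight_def)

lemma kernel_commute: "k u v x y = k v u x y"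
  by (simp add: nl_integrand_def mult.commute)

lemma kernel_add: "k (\<lambda>x. u x + v x) w x y = k u w x y + k v w x y"
  by (simp add: nl_integrand_def algebra_simps add_divide_distrib diff_divide_distrib)

lemma kernel_scale: "k (\<lambda>x. c * u x) w x y = c * k u w x y"
  by (simp add: nl_integrand_def algebra_simps add_divide_distrib diff_divide_distrib)

text \<open>A nonnegative weight times a product of two differences, so \<bar>a b\<bar> \<le> a^2 +
  b^2 applies pointwise. This makes mixed kernels integrable for functions of finite energy.\<close>

lemma kernel_abs_le: "\<bar>k u v x y\<bar> \<le> k u u x y + k v v x y"
proof -
  have *: "\<bar>a * b\<bar> \<le> a * a + b * b" for a b :: real
  proof -
    have "0 \<le> (a - b)\<^sup>2 + a\<^sup>2 + b\<^sup>2" "0 \<le> (a + b)\<^sup>2 + a\<^sup>2 + b\<^sup>2" by auto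
    then show ?thesis by (simp add: power2_eq_square algebra_simps abs_le_iff)
  qed
  let ?c = "weight \<beta> q lam \<delta> x * indicator {y. \<bar>y - x\<bar> < eta q lam \<delta> x} y / \<bar>x - y\<bar> powr \<beta>"
  have k: "k u v x y = ?c * ((u x - u y) * (v x - v y))" for u v
    by (simp add: nl_integrand_def)
  have "0 \<le> ?c" using beta by (simp add: weight_def)
  then show ?thesis
    unfolding k abs_mult [of ?c] distrib_left [symmetric] abs_of_nonneg [OF \<open>0 \<le> ?c\<close>]
    by (intro mult_left_mono * )
qed

lemma kernel_measurable:
  assumes "u \<in> borel_measurable (lebesgue_on \<Omega>)" "v \<in> borel_measurable (lebesgue_on \<Omega>)"
  shows "(\<lambda>(x, y). k u v x y) \<in> borel_measurable P"
proof -
  have [measurable]: "(\<lambda>x. x) \<in> borel_measurable (lebesgue_on \<Omega>)"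
    by (intro continuous_on_borel_measurable_Omega continuous_intros)
  note [measurable] = assms eta_measurable
  \<comment> \<open>The indicator is of a set that varies with \<open>x\<close>; as a conditional it
    is visibly jointly measurable.\<close>
  have "k u v = (\<lambda>x y. weight \<beta> q lam \<delta> x * (if \<bar>y - x\<bar> < eta q lam \<delta> x then 1 else 0) *
      ((u x - u y) * (v x - v y) / \<bar>x - y\<bar> powr \<beta>))"
    by (simp add: nl_integrand_def indicator_def fun_eq_iff)
  then show ?thesis
    unfolding weight_def by simp
qed

text \<open>Tonelli. Finite energy becomes integrability on the product space, where
  \<open>B\<close> is a single integral and its linearity is that of the Lebesgue integral.\<close>

lemma W_iff: "u \<in> W \<longleftrightarrow> u \<in> L2 \<and> integrable P (\<lambda>(x, y). k u u x y)"
proof (cases "u \<in> L2")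
  case True
  then have meas: "(\<lambda>(x, y). k u u x y) \<in> borel_measurable P"
    by (intro kernel_measurable) (auto simp: L2_def)
  have "(\<integral>\<^sup>+x. (\<integral>\<^sup>+y. ennreal (k u u x y) \<partial>lebesgue_on \<Omega>) \<partial>lebesgue_on \<Omega>) =
      (\<integral>\<^sup>+z. ennreal (case z of (x, y) \<Rightarrow> k u u x y) \<partial>P)"
    using M1.nn_integral_fst [of "\<lambda>z. ennreal (case z of (x, y) \<Rightarrow> k u u x y)"] meas by simp
  also have "\<dots> = (\<integral>\<^sup>+z. ennreal (norm (case z of (x, y) \<Rightarrow> k u u x y)) \<partial>P)"
    using kernel_nonneg by (intro nn_integral_cong) auto
  finally show ?thesis
    using True meas by (simp add: W_space_def integrable_iff_bounded)
qed (simp add: W_space_def)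

lemma W_subset_L2: "u \<in> W \<Longrightarrow> u \<in> L2"
  by (simp add: W_iff)

lemma kernel_integrable:
  assumes "u \<in> W" "v \<in> W"
  shows "integrable P (\<lambda>(x, y). k u v x y)"
proof (rule Bochner_Integration.integrable_bound)
  show "integrable P (\<lambda>z. (case z of (x, y) \<Rightarrow> k u u x y) + (case z of (x, y) \<Rightarrow> k v v x y))"
    using assms by (auto simp: W_iff)
  show "(\<lambda>(x, y). k u v x y) \<in> borel_measurable P"
    using assms by (intro kernel_measurable) (auto simp: W_iff L2_def)
  show "AE z in P. norm (case z of (x, y) \<Rightarrow> k u v x y) \<le>
      norm ((case z of (x, y) \<Rightarrow> k u u x y) + (case z of (x, y) \<Rightarrow> k v v x y))"
    using kernel_abs_le kernel_nonneg by (auto intro!: AE_I2 simp: abs_of_nonneg)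
qed

lemma B_eq_integral: "\<lbrakk>u \<in> W; v \<in> W\<rbrakk> \<Longrightarrow> B u v = (\<integral>(x, y). k u v x y \<partial>P)"
  unfolding B_nl_def by (rule integral_fst [OF kernel_integrable])

lemma W_add:
  assumes "u \<in> W" "v \<in> W" shows "(\<lambda>x. u x + v x) \<in> W"
proof -
  have "integrable P (\<lambda>z. (case z of (x, y) \<Rightarrow> k u u x y) + 2 * (case z of (x, y) \<Rightarrow> k u v x y)
      + (case z of (x, y) \<Rightarrow> k v v x y))"
    using assms kernel_integrable by auto
  moreover have "k (\<lambda>x. u x + v x) (\<lambda>x. u x + v x) x y = k u u x y + 2 * k u v x y + k v v x y" for x y
    by (simp add: kernel_add kernel_commute [of _ "\<lambda>x. u x + v x"] kernel_commute [of v u])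
  ultimately show ?thesis
    using assms by (auto simp: W_iff case_prod_beta' intro: L2_add)
qed

lemma W_scale:
  assumes "u \<in> W" shows "(\<lambda>x. c * u x) \<in> W"
  using assms by (auto simp: W_iff L2_scale kernel_scale integrable_mult_right kernel_commute [of _ "\<lambda>x. c * u x"] case_prod_beta')

lemma W_diff:
  assumes "u \<in> W" "v \<in> W" shows "(\<lambda>x. u x - v x) \<in> W"
  using W_add [OF assms(1) W_scale [OF assms(2), of "- 1"]] by simp

lemma B_commute: "B u v = B v u"
  unfolding B_nl_def by (intro Bochner_Integration.integral_cong refl kernel_commute)

lemma B_add:
  assumes "u \<in> W" "v \<in> W" "w \<in> W" shows "B (\<lambda>x. u x + v x) w = B u w + B v w"
  using kernel_integrable [OF assms(1,3)] kernel_integrable [OF assms(2,3)]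
  by (simp add: B_eq_integral W_add assms kernel_add case_prod_beta')

lemma B_scale:
  assumes "u \<in> W" "w \<in> W" shows "B (\<lambda>x. c * u x) w = c * B u w"
  by (simp add: B_eq_integral W_scale assms kernel_scale case_prod_beta')

lemma B_diff:
  assumes "u \<in> W" "v \<in> W" "w \<in> W" shows "B (\<lambda>x. u x - v x) w = B u w - B v w"
  using B_add [OF assms(1) W_scale [OF assms(2), of "- 1"] assms(3)] B_scale [OF assms(2,3), of "- 1"]
  by simp

text \<open>Valid for every \<open>u\<close>, also outside \<open>W\<close>: an integral that does
  not exist has the value 0 by convention.\<close>

lemma B_nonneg: "0 \<le> B u u"
  unfolding B_nl_def by (intro Bochner_Integration.integral_nonneg kernel_nonneg)

section \<open>The energy inner product and the Cauchy-Schwarz inequality\<close>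

definition ip :: "(real \<Rightarrow> real) \<Rightarrow> (real \<Rightarrow> real) \<Rightarrow> real"
  where "ip u v = L2_inner u v + B u v"

definition nrm :: "(real \<Rightarrow> real) \<Rightarrow> real"
  where "nrm u = sqrt (ip u u)"

lemma L2_inner_nonneg: "0 \<le> L2_inner u u"
  by (simp add: L2_inner_def)

lemma ip_nonneg: "0 \<le> ip u u"
  by (simp add: ip_def L2_inner_nonneg B_nonneg)

lemma nrm_nonneg: "0 \<le> nrm u"
  by (simp add: nrm_def ip_nonneg)

lemma W_norm_eq: "u \<in> W \<Longrightarrow> W_norm \<beta> q lam \<delta> u = ennreal (nrm u)"
  by (simp add: W_norm_def nrm_def ip_def L2_norm_def L2_inner_nonneg)

lemma ip_commute: "ip u v = ip v u"
  by (simp add: ip_def L2_inner_commute B_commute)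

lemma ip_add: "\<lbrakk>u \<in> W; v \<in> W; w \<in> W\<rbrakk> \<Longrightarrow> ip (\<lambda>x. u x + v x) w = ip u w + ip v w"
  by (simp add: ip_def L2_inner_add_left B_add W_subset_L2)

lemma ip_scale: "\<lbrakk>u \<in> W; w \<in> W\<rbrakk> \<Longrightarrow> ip (\<lambda>x. c * u x) w = c * ip u w"
  by (simp add: ip_def L2_inner_commute [of _ w] L2_inner_scale_right B_scale algebra_simps)

text \<open>The quadratic polynomial t -> b(u + t v, u + t v) is nonnegative. The form is kept
  abstract because it is taken to be \<open>B\<close> for the continuity estimate and
  \<open>ip\<close> for the triangle inequality.\<close>

lemma Cauchy_Schwarz_symmetric_form:
  assumes commute: "\<And>u v. b u v = b v u"
    and add: "\<And>u v w. \<lbrakk>u \<in> W; v \<in> W; w \<in> W\<rbrakk> \<Longrightarrow> b (\<lambda>x. u x + v x) w = b u w + b v w"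
    and scale: "\<And>u w c. \<lbrakk>u \<in> W; w \<in> W\<rbrakk> \<Longrightarrow> b (\<lambda>x. c * u x) w = c * b u w"
    and nonneg: "\<And>u. 0 \<le> b u u"
    and uv: "u \<in> W" "v \<in> W"
  shows "\<bar>b u v\<bar> \<le> sqrt (b u u) * sqrt (b v v)"
proof -
  have "0 \<le> b u u + 2 * t * b u v + t\<^sup>2 * b v v" for t :: real
  proof -
    have tv: "(\<lambda>x. t * v x) \<in> W" "(\<lambda>x. u x + t * v x) \<in> W"
      using uv W_scale W_add by blast+
    have "b (\<lambda>x. u x + t * v x) (\<lambda>x. u x + t * v x) =
        b u (\<lambda>x. u x + t * v x) + t * b v (\<lambda>x. u x + t * v x)"
      using uv tv by (simp add: add scale)
    also have "\<dots> = b u u + 2 * t * b u v + t\<^sup>2 * b v v"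
      using uv tv by (simp add: commute [of _ "\<lambda>x. u x + t * v x"] add scale commute [of v u]
          algebra_simps power2_eq_square)
    finally show ?thesis by (metis nonneg)
  qed
  then have "(b u v)\<^sup>2 \<le> b u u * b v v" by (rule nonneg_quadratic_discriminant [OF _ nonneg])
  then show ?thesis by (metis real_sqrt_abs real_sqrt_le_iff real_sqrt_mult)
qed

lemma B_le_nrm:
  assumes "u \<in> W" "v \<in> W" shows "\<bar>B u v\<bar> \<le> nrm u * nrm v"
proof -
  have "\<bar>B u v\<bar> \<le> sqrt (B u u) * sqrt (B v v)"
    by (rule Cauchy_Schwarz_symmetric_form [of "B_nl \<beta> q lam \<delta>"])
      (assumption | rule B_commute B_add B_scale B_nonneg assms)+
  also have "\<dots> \<le> nrm u * nrm v"
    unfolding nrm_def ip_def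
    by (intro mult_mono real_sqrt_le_mono) (auto simp: L2_inner_nonneg B_nonneg)
  finally show ?thesis .
qed

lemma nrm_triangle:
  assumes "u \<in> W" "v \<in> W" shows "nrm (\<lambda>x. u x + v x) \<le> nrm u + nrm v"
proof -
  have "\<bar>ip u v\<bar> \<le> nrm u * nrm v"
    unfolding nrm_def
    by (rule Cauchy_Schwarz_symmetric_form [of ip])
      (assumption | rule ip_commute ip_add ip_scale ip_nonneg assms)+
  moreover have "(nrm u)\<^sup>2 = ip u u" for u by (simp add: nrm_def ip_nonneg)
  moreover have "ip (\<lambda>x. u x + v x) (\<lambda>x. u x + v x) = ip u u + 2 * ip u v + ip v v"
    using ip_add [OF assms W_add [OF assms]] ip_add [OF assms assms(1)] ip_add [OF assms assms(2)]
      ip_commute [of u "\<lambda>x. u x + v x"] ip_commute [of v "\<lambda>x. u x + v x"] ip_commute [of v u]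
    by linarith
  ultimately have "(nrm (\<lambda>x. u x + v x))\<^sup>2 \<le> (nrm u + nrm v)\<^sup>2"
    by (simp add: power2_sum)
  then show ?thesis by (rule power2_le_imp_le) (simp add: nrm_nonneg)
qed

text \<open>The kernel at \<open>x\<close> is at most the weight times L^2 \<bar>x - y\<bar>^(2 -
  \<beta>). The integral of this power over a window of radius r is 2 r^(3 - \<beta>) / (3 -
  \<beta>), exactly the reciprocal of the weight at r = \<eta>(x), so the inner integral is at most
  L^2 for every \<open>x\<close>.\<close>

lemma Lipschitz_in_W:
  assumes L: "L-lipschitz_on {0..1} u" shows "u \<in> W"
proof -
  have u: "u \<in> L2"
    by (rule continuous_on_L2 [OF lipschitz_on_continuous_on [OF L]])
  have "(\<integral>\<^sup>+y. ennreal (k u u x y) \<partial>lebesgue_on \<Omega>) \<le> ennreal (L\<^sup>2)" if x: "x \<in> \<Omega>" for x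
  proof -
    let ?e = "eta q lam \<delta> x" and ?a = "2 - \<beta>"
    let ?c = "weight \<beta> q lam \<delta> x * L\<^sup>2"
    have e: "0 < ?e" and c: "0 \<le> ?c" using eta_pos [OF x] beta by (auto simp: weight_def)
    have le: "k u u x y \<le> indicator {x - ?e..x + ?e} y * (?c * \<bar>x - y\<bar> powr ?a)" if y: "y \<in> \<Omega>" for y
    proof (cases "x \<noteq> y \<and> \<bar>y - x\<bar> < ?e")
      case True
      have "\<bar>u x - u y\<bar> \<le> L * \<bar>x - y\<bar>"
        using lipschitz_onD [OF L, of x y] x y by (auto simp: dist_real_def)
      then have "(u x - u y)\<^sup>2 \<le> L\<^sup>2 * \<bar>x - y\<bar>\<^sup>2"
        using power_mono [of "\<bar>u x - u y\<bar>" "L * \<bar>x - y\<bar>" 2] by (simp add: power_mult_distrib)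
      also have "\<bar>x - y\<bar>\<^sup>2 = \<bar>x - y\<bar> powr ?a * \<bar>x - y\<bar> powr \<beta>"
        using True by (simp flip: powr_add)
      finally have "(u x - u y) * (u x - u y) / \<bar>x - y\<bar> powr \<beta> \<le> L\<^sup>2 * \<bar>x - y\<bar> powr ?a"
        using True by (simp add: divide_le_eq power2_eq_square mult.assoc)
      then have "weight \<beta> q lam \<delta> x * ((u x - u y) * (u x - u y) / \<bar>x - y\<bar> powr \<beta>)
          \<le> weight \<beta> q lam \<delta> x * (L\<^sup>2 * \<bar>x - y\<bar> powr ?a)"
        using beta by (intro mult_left_mono) (auto simp: weight_def)
      then show ?thesis using True by (auto simp: nl_integrand_def indicator_def mult.assoc)
    qed (use c in \<open>auto simp: nl_integrand_def indicator_def\<close>)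
    have int: "((\<lambda>y. ?c * \<bar>x - y\<bar> powr ?a) has_integral (?c * (2 * ?e powr (?a + 1) / (?a + 1)))) {x - ?e..x + ?e}"
      using beta e by (intro has_integral_mult_right has_integral_abs_powr) auto
    have "(\<integral>\<^sup>+y. ennreal (k u u x y) \<partial>lebesgue_on \<Omega>)
        \<le> (\<integral>\<^sup>+y. ennreal (indicator {x - ?e..x + ?e} y * (?c * \<bar>x - y\<bar> powr ?a)) \<partial>lebesgue_on \<Omega>)"
      using le by (intro nn_integral_mono ennreal_leI) auto
    also have "\<dots> = (\<integral>\<^sup>+y. ennreal (indicator {x - ?e..x + ?e} y * (?c * \<bar>x - y\<bar> powr ?a)) * indicator \<Omega> y \<partial>lebesgue)"
      by (rule nn_integral_restrict_space) simp
    also have "\<dots> \<le> (\<integral>\<^sup>+y. ennreal (indicator {x - ?e..x + ?e} y * (?c * \<bar>x - y\<bar> powr ?a)) \<partial>lebesgue)"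
      by (intro nn_integral_mono) (auto simp: indicator_def)
    also have "\<dots> = (\<integral>\<^sup>+y. ennreal (indicator {x - ?e..x + ?e} y * (?c * \<bar>x - y\<bar> powr ?a)) \<partial>lborel)"
      by (simp add: nn_integral_completion)
    also have "\<dots> = ennreal (?c * (2 * ?e powr (?a + 1) / (?a + 1)))"
      by (rule nn_integral_has_integral_lebesgue [OF _ int]) (use c in auto)
    also have "?c * (2 * ?e powr (?a + 1) / (?a + 1)) = L\<^sup>2 * (?e powr (- (3 - \<beta>)) * ?e powr (3 - \<beta>))"
    proof -
      have "c / 2 * X * L\<^sup>2 * (2 * Y / c) = L\<^sup>2 * (X * Y)" if "c \<noteq> 0" for c X Y :: real
        using that by simp
      moreover have "?a + 1 = 3 - \<beta>" by simp
      ultimately show ?thesis using beta unfolding weight_def by simp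
    qed
    also have "\<dots> = L\<^sup>2" using e by (simp flip: powr_add)
    finally show ?thesis .
  qed
  then have "(\<integral>\<^sup>+x. (\<integral>\<^sup>+y. ennreal (k u u x y) \<partial>lebesgue_on \<Omega>) \<partial>lebesgue_on \<Omega>)
      \<le> (\<integral>\<^sup>+x. ennreal (L\<^sup>2) \<partial>lebesgue_on \<Omega>)"
    by (intro nn_integral_mono) auto
  also have "\<dots> < \<infinity>" by (simp add: emeasure_restrict_space)
  finally show ?thesis using u by (simp add: W_space_def)
qed

end

text \<open>Each affine piece is Lipschitz on a half-open interval and, by continuity, on its
  closure. Finitely many closed intervals are then joined; the sum of the piecewise constants serves
  for all of them.\<close>

lemma fe_space_lipschitz:
  assumes "v \<in> fe_space N" "1 \<le> N"
  shows "\<exists>L. L-lipschitz_on {0..1} v"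
proof -
  define U where "U i = {(real i - 1) / real N .. real i / real N}" for i
  have v: "continuous_on {0..1} v"
    and aff: "\<forall>i\<in>{1..N}. \<exists>a b. \<forall>x\<in>{(real i - 1) / real N <.. real i / real N}. v x = a + b * x"
    using assms by (auto simp: fe_space_def)
  have "\<exists>L. L-lipschitz_on (U i) v" if i: "i \<in> {1..N}" for i
  proof -
    obtain a b where ab: "\<And>x. x \<in> {(real i - 1) / real N <.. real i / real N} \<Longrightarrow> v x = a + b * x"
      using aff i by blast
    have "\<bar>b\<bar>-lipschitz_on {(real i - 1) / real N <.. real i / real N} v"
      by (rule lipschitz_onI) (auto simp: ab dist_real_def simp flip: right_diff_distrib abs_mult)
    moreover have cl: "closure {(real i - 1) / real N <.. real i / real N} = U i"
      using assms(2) by (simp add: U_def divide_strict_right_mono)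
    moreover have "continuous_on (U i) v"
      using i assms(2) by (intro continuous_on_subset [OF v]) (auto simp: U_def field_simps)
    ultimately have "\<bar>b\<bar>-lipschitz_on (U i) v"
      using lipschitz_on_closure [of "\<bar>b\<bar>" "{(real i - 1) / real N <.. real i / real N}" v] by simp
    then show ?thesis ..
  qed
  then obtain L where L: "\<And>i. i \<in> {1..N} \<Longrightarrow> (L i)-lipschitz_on (U i) v" by metis
  define K where "K = (\<Sum>i=1..N. L i)"
  have Lnn: "0 \<le> L i" if "i \<in> {1..N}" for i using L [OF that] by (rule lipschitz_on_nonneg)
  have "K-lipschitz_on {0..1} v"
  proof (rule lipschitz_on_closed_Union [where I = "{1..N}" and U = U])
    show "K-lipschitz_on (U i) v" if "i \<in> {1..N}" for i
      using L [OF that] by (rule lipschitz_on_le) (use Lnn that in \<open>auto simp: K_def intro: member_le_sum\<close>)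
    show "0 \<le> K" using Lnn by (auto simp: K_def intro: sum_nonneg)
    show "{0..1} \<subseteq> (\<Union>i\<in>{1..N}. U i)"
    proof
      fix x :: real assume x: "x \<in> {0..1}"
      show "x \<in> (\<Union>i\<in>{1..N}. U i)"
      proof (cases "x = 0")
        case True
        then show ?thesis using assms(2) by (auto intro!: bexI [of _ 1] simp: U_def)
      next
        case False
        \<comment> \<open>Rounding up matches the pieces that are closed on the right; at x = 0 it
          would give the index 0, hence the separate case.\<close>
        define i where "i = nat \<lceil>x * real N\<rceil>"
        have "0 < x * real N" "x * real N \<le> real N"
          using x False assms(2) by (auto simp: mult_left_le_one_le)
        then have "i \<in> {1..N}" "real i - 1 \<le> x * real N" "x * real N \<le> real i"
          unfolding i_def by (auto simp: Suc_le_eq)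
        then show ?thesis using assms(2)
          by (intro UN_I [of i]) (auto simp: U_def field_simps)
      qed
    qed
  qed (auto simp: U_def)
  then show ?thesis by blast
qed

subsection \<open>A Poincare inequality uniform in the horizon\<close>

text \<open>The integral of (f + t)^2 is a nonnegative quadratic polynomial in
  \<open>t\<close>.\<close>

lemma Cauchy_Schwarz_interval:
  fixes f :: "real \<Rightarrow> real"
  assumes f: "continuous_on {a..b} f" and "a \<le> b"
  shows "(integral {a..b} f)\<^sup>2 \<le> (b - a) * integral {a..b} (\<lambda>x. (f x)\<^sup>2)"
proof -
  have int: "f integrable_on {a..b}" "(\<lambda>x. (f x)\<^sup>2) integrable_on {a..b}"
    using f by (auto intro!: integrable_continuous_interval continuous_intros)
  have "0 \<le> integral {a..b} (\<lambda>x. (f x)\<^sup>2) + 2 * t * integral {a..b} f + t\<^sup>2 * (b - a)" for t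
  proof -
    have "((\<lambda>x. (f x)\<^sup>2 + 2 * t * f x + t\<^sup>2) has_integral
        (integral {a..b} (\<lambda>x. (f x)\<^sup>2) + 2 * t * integral {a..b} f + t\<^sup>2 * (b - a))) {a..b}"
      using int has_integral_const_real [of "t\<^sup>2" a b] \<open>a \<le> b\<close>
      by (intro has_integral_add has_integral_mult_right integrable_integral) (auto simp: mult.commute)
    then show ?thesis
    proof (rule has_integral_nonneg)
      fix x
      have "(f x)\<^sup>2 + 2 * t * f x + t\<^sup>2 = (f x + t)\<^sup>2" by (simp add: power2_sum)
      then show "0 \<le> (f x)\<^sup>2 + 2 * t * f x + t\<^sup>2" by simp
    qed
  qed
  from nonneg_quadratic_discriminant [OF this] show ?thesis
    using \<open>a \<le> b\<close> by (simp add: mult.commute)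
qed

text \<open>Passes between the Lebesgue integrals that define \<open>B\<close> and the gauge
  integrals to which the fundamental theorem of calculus applies.\<close>

lemma integral_indicator_interval:
  fixes g :: "real \<Rightarrow> real"
  assumes g: "continuous_on {a..b} g" and ab: "0 \<le> a" "b \<le> 1"
  shows "integrable (lebesgue_on \<Omega>) (\<lambda>y. indicator {a<..<b} y * g y)"
    and "(\<integral>y. indicator {a<..<b} y * g y \<partial>lebesgue_on \<Omega>) = integral {a..b} g"
proof -
  have "g absolutely_integrable_on {a<..<b}"
    using absolutely_integrable_continuous_real [OF g]
    by (rule set_integrable_subset) auto
  then have gi: "integrable (lebesgue_on {a<..<b}) g"
    by (simp add: integrable_restrict_space set_integrable_def)
  have eq: "indicator \<Omega> y * (indicator {a<..<b} y * g y) = indicator {a<..<b} y * g y" for y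
    using ab by (auto simp: indicator_def)
  show "integrable (lebesgue_on \<Omega>) (\<lambda>y. indicator {a<..<b} y * g y)"
    using gi by (subst integrable_restrict_space) (simp_all add: integrable_restrict_space eq)
  have "(\<integral>y. indicator {a<..<b} y * g y \<partial>lebesgue_on \<Omega>) = (\<integral>y. g y \<partial>lebesgue_on {a<..<b})"
    by (simp add: integral_restrict_space eq)
  also have "\<dots> = integral {a<..<b} g"
    by (rule lebesgue_integral_eq_integral [OF gi]) simp
  also have "\<dots> = integral {a..b} g"
    by (simp add: integral_open_interval_real)
  finally show "(\<integral>y. indicator {a<..<b} y * g y \<partial>lebesgue_on \<Omega>) = integral {a..b} g" .
qed

text \<open>\<open>eta_right\<close> keeps the one-sided window inside the unit interval,
  \<open>eta_le\<close> shrinks it towards 0 so that the average inherits the boundary value there,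
  and the bound on \<open>e'\<close> controls the derivative of the average.\<close>

locale nonlocal_form_C1 = nonlocal_form +
  fixes e' :: "real \<Rightarrow> real"
  assumes eta_le: "x \<in> \<Omega> \<Longrightarrow> eta q lam \<delta> x \<le> x"
    and eta_right: "x \<in> \<Omega> \<Longrightarrow> x + eta q lam \<delta> x < 1"
    and eta_deriv: "x \<in> \<Omega> \<Longrightarrow> (eta q lam \<delta> has_real_derivative e' x) (at x)"
    and eta_deriv_continuous: "continuous_on \<Omega> e'"
    and eta_deriv_bound: "x \<in> \<Omega> \<Longrightarrow> \<bar>e' x\<bar> \<le> 1 / 3"
begin

abbreviation "e \<equiv> eta q lam \<delta>"

text \<open>The one-sided mollification \<open>A x = 2 / (e x)\<^sup>2 * (\<integral>y=x..x+e x. (x + e x - y) * u y)\<close>,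
  written with the iterated antiderivatives \<open>U\<close>, \<open>UU\<close> of \<open>u\<close> so that the chain rule suffices to
  differentiate it.\<close>

lemma mollification:
  fixes u :: "real \<Rightarrow> real"
  assumes u: "continuous_on {0..1} u"
  obtains A D where
    "\<And>x. x \<in> \<Omega> \<Longrightarrow> (A has_real_derivative D x) (at x)" "continuous_on \<Omega> D"
    "\<And>x. x \<in> \<Omega> \<Longrightarrow> \<bar>D x\<bar> \<le> 4 / (e x)\<^sup>2 * integral {x..x + e x} (\<lambda>y. \<bar>u y - u x\<bar>)"
    "\<And>x. x \<in> \<Omega> \<Longrightarrow> \<bar>A x - u x\<bar> \<le> 2 / e x * integral {x..x + e x} (\<lambda>y. \<bar>u y - u x\<bar>)"
proof -
  obtain U where U: "\<And>t. t \<in> {0..1} \<Longrightarrow> (U has_vector_derivative u t) (at t within {0..1})"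
    using antiderivative_continuous [OF u] by blast
  then have Uc: "continuous_on {0..1} U"
    by (rule continuous_on_vector_derivative)
  then obtain UU where UU: "\<And>t. t \<in> {0..1} \<Longrightarrow> (UU has_vector_derivative U t) (at t within {0..1})"
    using antiderivative_continuous by blast
  have dU: "(U has_real_derivative u t) (at t)" and dUU: "(UU has_real_derivative U t) (at t)"
    if "t \<in> \<Omega>" for t
  proof -
    have "at t within {0..1} = at t" using that by (intro at_within_interior) auto
    then show "(U has_real_derivative u t) (at t)" "(UU has_real_derivative U t) (at t)"
      using U [of t] UU [of t] that by (auto simp: has_real_derivative_iff_has_vector_derivative)
  qed
  define M where "M x = integral {x..x + e x} (\<lambda>y. \<bar>u y - u x\<bar>)" for x
  \<comment> \<open>\<open>v1\<close> is the integral of u y - u x over the window, and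
    \<open>v2\<close> the same with the linear kernel x + e x - y. Both vanish for constant
    \<open>u\<close>, which is why \<open>D\<close> is written in terms of them; moreover
    \<open>A x - u x\<close> is 2 / (e x)^2 times \<open>v2\<close>.\<close>
  define v1 where "v1 x = U (x + e x) - U x - u x * e x" for x
  define v2 where "v2 x = UU (x + e x) - UU x - e x * U x - u x * (e x)\<^sup>2 / 2" for x
  define A where "A x = 2 * (UU (x + e x) - UU x - e x * U x) / (e x)\<^sup>2" for x
  define D where "D x = 2 * (1 + e' x) / (e x)\<^sup>2 * v1 x - 4 * e' x / (e x) ^ 3 * v2 x" for x
  have inside: "0 < e x" "x + e x < 1" "0 < x" if "x \<in> \<Omega>" for x
    using eta_pos [OF that] eta_right [OF that] that by auto
  have dA: "(A has_real_derivative D x) (at x)" if x: "x \<in> \<Omega>" for x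
  proof -
    note ex = inside [OF x]
    have xe: "x + e x \<in> \<Omega>" using ex by simp
    have d1: "((\<lambda>x. x + e x) has_real_derivative 1 + e' x) (at x)"
      by (intro derivative_intros eta_deriv x)
    have d2: "((\<lambda>x. UU (x + e x)) has_real_derivative U (x + e x) * (1 + e' x)) (at x)"
      by (rule DERIV_chain2 [OF dUU [OF xe] d1])
    have "(A has_real_derivative
        ((2 * (U (x + e x) * (1 + e' x) - U x - (e' x * U x + u x * e x))) * (e x)\<^sup>2 -
         (2 * (UU (x + e x) - UU x - e x * U x)) * (2 * e x * e' x)) / ((e x)\<^sup>2 * (e x)\<^sup>2)) (at x)"
      unfolding A_def
      by (intro DERIV_divide DERIV_cmult DERIV_diff d2 dUU dU x DERIV_mult eta_deriv)
        (use ex in \<open>auto intro!: derivative_eq_intros eta_deriv x\<close>)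
    moreover have "((2 * (U (x + e x) * (1 + e' x) - U x - (e' x * U x + u x * e x))) * (e x)\<^sup>2 -
         (2 * (UU (x + e x) - UU x - e x * U x)) * (2 * e x * e' x)) / ((e x)\<^sup>2 * (e x)\<^sup>2) = D x"
    proof -
      \<comment> \<open>The terms in w = u x hidden in \<open>v1\<close> and \<open>v2\<close> add
        up to -2 w / r, the term that the derivative of \<open>U\<close> produces on the
        left.\<close>
      have "((2 * (U1 * (1 + d) - U0 - (d * U0 + w * r))) * r\<^sup>2 - (2 * (W1 - W0 - r * U0)) * (2 * r * d)) / (r\<^sup>2 * r\<^sup>2)
        = 2 * (1 + d) / r\<^sup>2 * (U1 - U0 - w * r) - 4 * d / r ^ 3 * (W1 - W0 - r * U0 - w * r\<^sup>2 / 2)"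
        if "r \<noteq> 0" for U0 U1 W0 W1 d w r :: real
        using that by (simp add: divide_simps) (simp add: algebra_simps eval_nat_numeral)
      then show ?thesis unfolding D_def v1_def v2_def using ex by auto
    qed
    ultimately show ?thesis by simp
  qed
  have ec: "continuous_on \<Omega> e"
    using eta_deriv by (meson DERIV_isCont continuous_at_imp_continuous_on)
  have Dc: "continuous_on \<Omega> D"
  proof -
    have maps: "x + e x \<in> {0..1}" if "x \<in> \<Omega>" for x
      using eta_pos [OF that] eta_right [OF that] that by simp
    have c: "continuous_on \<Omega> (\<lambda>x. g (x + e x))" "continuous_on \<Omega> g"
      if g: "continuous_on {0..1} g" for g :: "real \<Rightarrow> real"
    proof -
      show "continuous_on \<Omega> (\<lambda>x. g (x + e x))"
        by (rule continuous_on_compose2 [OF g continuous_on_add [OF continuous_on_id ec]]) (use maps in blast)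
      show "continuous_on \<Omega> g" by (rule continuous_on_subset [OF g]) auto
    qed
    have UUc: "continuous_on {0..1} UU"
      using UU by (rule continuous_on_vector_derivative)
    show ?thesis
      unfolding D_def v1_def v2_def
      by (intro continuous_intros c [OF Uc] c [OF UUc] c(2) [OF u] ec eta_deriv_continuous)
        (auto dest: eta_pos)
  qed
  \<comment> \<open>The quantity on the left is the integral of u y - u x from \<open>x\<close> to
    \<open>t\<close>. The endpoint t = x + e x gives the bound for \<open>v1\<close>, and the mean
    value theorem reduces \<open>v2\<close> to an intermediate \<open>t\<close>.\<close>
  have V: "\<bar>U t - U x - u x * (t - x)\<bar> \<le> M x" if x: "x \<in> \<Omega>" and t: "t \<in> {x..x + e x}" for x t
  proof -
    note ex = inside [OF x]
    have cont: "continuous_on {x..x + e x} (\<lambda>y. u y - u x)"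
      using ex by (intro continuous_intros continuous_on_subset [OF u]) auto
    then have i: "(\<lambda>y. \<bar>u y - u x\<bar>) integrable_on {x..x + e x}"
      by (intro integrable_continuous_interval continuous_on_rabs)
    have cont': "continuous_on {x..t} (\<lambda>y. u y - u x)"
      by (rule continuous_on_subset [OF cont]) (use t in auto)
    have "((\<lambda>y. u y - u x) has_integral ((U t - u x * t) - (U x - u x * x))) {x..t}"
    proof (rule fundamental_theorem_of_calculus)
      fix y assume "y \<in> {x..t}"
      then have "y \<in> \<Omega>" using ex t by auto
      then have "((\<lambda>y. U y - u x * y) has_real_derivative (u y - u x)) (at y)"
        by (auto intro!: derivative_eq_intros dU)
      then show "((\<lambda>y. U y - u x * y) has_vector_derivative u y - u x) (at y within {x..t})"
        by (auto simp flip: has_real_derivative_iff_has_vector_derivative intro: DERIV_subset)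
    qed (use t in auto)
    then have "\<bar>U t - U x - u x * (t - x)\<bar> = \<bar>integral {x..t} (\<lambda>y. u y - u x)\<bar>"
      by (simp add: integral_unique algebra_simps)
    also have "\<dots> \<le> integral {x..t} (\<lambda>y. \<bar>u y - u x\<bar>)"
      unfolding real_norm_def [symmetric] using cont'
      by (intro Henstock_Kurzweil_Integration.integral_norm_bound_integral
          integrable_continuous_interval continuous_on_norm) auto
    also have "\<dots> \<le> M x"
      unfolding M_def
      using t i cont cont' by (intro integral_subset_le integrable_continuous_interval continuous_on_rabs) auto
    finally show ?thesis .
  qed
  have v1: "\<bar>v1 x\<bar> \<le> M x" if "x \<in> \<Omega>" for x
    using V [OF that, of "x + e x"] inside [OF that] by (simp add: v1_def)
  have v2: "\<bar>v2 x\<bar> \<le> e x * M x" if x: "x \<in> \<Omega>" for x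
  proof -
    note ex = inside [OF x]
    have "\<exists>z. x < z \<and> z < x + e x \<and>
      (UU (x + e x) - (x + e x - x) * U x - u x * (x + e x - x)\<^sup>2 / 2) -
      (UU x - (x - x) * U x - u x * (x - x)\<^sup>2 / 2) = (x + e x - x) * (U z - U x - u x * (z - x))"
    proof (rule MVT2 [where f = "\<lambda>t. UU t - (t - x) * U x - u x * (t - x)\<^sup>2 / 2"
          and f' = "\<lambda>t. U t - U x - u x * (t - x)"])
      fix t assume "x \<le> t" "t \<le> x + e x"
      then have "t \<in> \<Omega>" using ex by auto
      then show "((\<lambda>t. UU t - (t - x) * U x - u x * (t - x)\<^sup>2 / 2) has_real_derivative
          U t - U x - u x * (t - x)) (at t)"
        by (auto intro!: derivative_eq_intros dUU)
    qed (use ex in auto)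
    then obtain z where z: "x < z" "z < x + e x" and "v2 x = e x * (U z - U x - u x * (z - x))"
      by (auto simp: v2_def)
    then show ?thesis using V [OF x, of z] ex by (simp add: abs_mult)
  qed
  have D: "\<bar>D x\<bar> \<le> 4 / (e x)\<^sup>2 * M x" if x: "x \<in> \<Omega>" for x
  proof -
    note ex = inside(1) [OF x] and d = eta_deriv_bound [OF x]
    have M: "0 \<le> M x" using v1 [OF x] by linarith
    have quot: "\<bar>a / r * v\<bar> \<le> c / r * w" if "\<bar>a\<bar> \<le> c" "0 < r" "\<bar>v\<bar> \<le> w" for a c r v w :: real
      unfolding abs_mult abs_divide using that
      by (intro mult_mono frac_le) auto
    \<comment> \<open>From \<bar>e'\<bar> \<le> 1/3 come the coefficients 2 (1 + 1/3) = 8/3 here and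
      4/3 for the second term, together 4.\<close>
    have "\<bar>2 * (1 + e' x) / (e x)\<^sup>2 * v1 x\<bar> \<le> (8 / 3) / (e x)\<^sup>2 * M x"
      by (rule quot [OF _ _ v1 [OF x]]) (use d ex in \<open>auto simp: abs_le_iff\<close>)
    moreover have "\<bar>4 * e' x / (e x) ^ 3 * v2 x\<bar> \<le> (4 / 3) / (e x) ^ 3 * (e x * M x)"
      by (rule quot [OF _ _ v2 [OF x]]) (use d ex in \<open>auto simp: abs_le_iff\<close>)
    moreover have "(4 / 3) / (e x) ^ 3 * (e x * M x) = (4 / 3) / (e x)\<^sup>2 * M x"
      using ex by (simp add: power2_eq_square power3_eq_cube)
    moreover have "(8 / 3) / (e x)\<^sup>2 * M x + (4 / 3) / (e x)\<^sup>2 * M x = 4 / (e x)\<^sup>2 * M x"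
      by (simp add: field_simps)
    ultimately show ?thesis unfolding D_def by linarith
  qed
  have A: "\<bar>A x - u x\<bar> \<le> 2 / e x * M x" if x: "x \<in> \<Omega>" for x
  proof -
    note ex = inside(1) [OF x]
    have "A x - u x = 2 / (e x)\<^sup>2 * v2 x"
      using ex by (simp add: A_def v2_def field_simps)
    then have "\<bar>A x - u x\<bar> = 2 / (e x)\<^sup>2 * \<bar>v2 x\<bar>" by (simp add: abs_mult)
    also have "\<dots> \<le> 2 / (e x)\<^sup>2 * (e x * M x)" by (intro mult_left_mono v2 x) auto
    also have "\<dots> = 2 / e x * M x" using ex by (simp add: power2_eq_square)
    finally show ?thesis .
  qed
  show thesis by (rule that [OF dA Dc D [unfolded M_def] A [unfolded M_def]])
qed

text \<open>Only the right half of the window is kept, and \<bar>x - y\<bar>^\<beta> is replaced by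
  the larger (e x)^\<beta>; with the weight this makes up the factor (e x)^(-3).\<close>

lemma kernel_integral_lower_bound:
  assumes u: "continuous_on {0..1} u" and x: "x \<in> \<Omega>"
    and int: "integrable (lebesgue_on \<Omega>) (k u u x)"
  shows "(3 - \<beta>) / 2 / (e x) ^ 3 * integral {x..x + e x} (\<lambda>y. (u y - u x)\<^sup>2)
    \<le> (\<integral>y. k u u x y \<partial>lebesgue_on \<Omega>)"
proof -
  let ?c = "(3 - \<beta>) / 2 / (e x) ^ 3"
  have ex: "0 < e x" "x + e x < 1" using eta_pos eta_right x by auto
  have cont: "continuous_on {x..x + e x} (\<lambda>y. ?c * (u y - u x)\<^sup>2)"
    using ex x by (intro continuous_intros continuous_on_subset [OF u]) auto
  have "?c * integral {x..x + e x} (\<lambda>y. (u y - u x)\<^sup>2) = integral {x..x + e x} (\<lambda>y. ?c * (u y - u x)\<^sup>2)"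
    by simp
  also have "\<dots> = (\<integral>y. indicator {x<..<x + e x} y * (?c * (u y - u x)\<^sup>2) \<partial>lebesgue_on \<Omega>)"
    using ex x by (intro integral_indicator_interval(2) [symmetric] cont) auto
  also have "\<dots> \<le> (\<integral>y. k u u x y \<partial>lebesgue_on \<Omega>)"
  proof (rule integral_mono)
    show "integrable (lebesgue_on \<Omega>) (\<lambda>y. indicator {x<..<x + e x} y * (?c * (u y - u x)\<^sup>2))"
      using ex x by (intro integral_indicator_interval(1) cont) auto
    show "indicator {x<..<x + e x} y * (?c * (u y - u x)\<^sup>2) \<le> k u u x y" for y
    proof (cases "y \<in> {x<..<x + e x}")
      case True
      have eq: "e x powr (- (3 - \<beta>)) / e x powr \<beta> = 1 / (e x) ^ 3"
      proof -
        have "e x powr (- (3 - \<beta>)) / e x powr \<beta> = e x powr (- (3 - \<beta>) - \<beta>)"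
          by (simp only: powr_diff)
        also have "- (3 - \<beta>) - \<beta> = - 3" by simp
        finally show ?thesis using ex by (simp add: powr_minus_divide)
      qed
      have "weight \<beta> q lam \<delta> x * ((u y - u x)\<^sup>2 / e x powr \<beta>)
          = (3 - \<beta>) / 2 * (e x powr (- (3 - \<beta>)) / e x powr \<beta>) * (u y - u x)\<^sup>2"
        by (simp add: weight_def)
      then have "?c * (u y - u x)\<^sup>2 = weight \<beta> q lam \<delta> x * ((u y - u x)\<^sup>2 / e x powr \<beta>)"
        unfolding eq by simp
      also have "\<dots> \<le> weight \<beta> q lam \<delta> x * ((u y - u x)\<^sup>2 / \<bar>x - y\<bar> powr \<beta>)"
        using True beta by (intro mult_left_mono divide_left_mono powr_mono2) (auto simp: weight_def)
      also have "\<dots> = k u u x y"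
        using True by (simp add: nl_integrand_def power2_commute [of "u y"] flip: power2_eq_square)
      finally show ?thesis using True by simp
    qed (simp add: kernel_nonneg)
  qed (fact int)
  finally show ?thesis .
qed

text \<open>From u^2 \<le> 2 A^2 + 2 (A - u)^2, where A^2 \<le> K B(u, u) and the second term is at
  most K/2 times the energy density. Integration gives 5/2 K with K = 32 / (3 - \<beta>).\<close>

lemma Poincare:
  assumes L: "L-lipschitz_on {0..1} u" and u0: "u 0 = 0"
  shows "L2_inner u u \<le> 80 / (3 - \<beta>) * B u u"
proof -
  have u: "continuous_on {0..1} u" using L by (rule lipschitz_on_continuous_on)
  have uW: "u \<in> W" using L by (rule Lipschitz_in_W)
  define I where "I x = (\<integral>y. k u u x y \<partial>lebesgue_on \<Omega>)" for x
  define M where "M x = integral {x..x + e x} (\<lambda>y. \<bar>u y - u x\<bar>)" for x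
  have I_int: "integrable (lebesgue_on \<Omega>) I"
    unfolding I_def by (rule integrable_fst [OF kernel_integrable [OF uW uW]])
  have BI: "B u u = (\<integral>x. I x \<partial>lebesgue_on \<Omega>)" by (simp add: B_nl_def I_def)
  obtain A D where A: "\<And>x. x \<in> \<Omega> \<Longrightarrow> (A has_real_derivative D x) (at x)" "continuous_on \<Omega> D"
    "\<And>x. x \<in> \<Omega> \<Longrightarrow> \<bar>D x\<bar> \<le> 4 / (e x)\<^sup>2 * M x"
    "\<And>x. x \<in> \<Omega> \<Longrightarrow> \<bar>A x - u x\<bar> \<le> 2 / e x * M x"
    using mollification [OF u] unfolding M_def by blast
  \<comment> \<open>The mollification bound squared contributes 16, the lower bound for the kernel
    integral 2 / (3 - \<beta>).\<close>
  define K where "K = 32 / (3 - \<beta>)"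
  have K: "0 < K" using beta by (simp add: K_def)
  have ex: "0 < e x" "e x < 1" "{x..x + e x} \<subseteq> {0..1}" if "x \<in> \<Omega>" for x
    using eta_pos [OF that] eta_right [OF that] that by auto
  \<comment> \<open>Almost everywhere only, since the slice of the kernel at \<open>x\<close> is
    known to be integrable for almost every \<open>x\<close>.\<close>
  have bounds: "AE x in lebesgue_on \<Omega>. (D x)\<^sup>2 \<le> K * I x \<and> 4 * (A x - u x)\<^sup>2 \<le> K * I x"
  proof -
    have "AE x in lebesgue_on \<Omega>. integrable (lebesgue_on \<Omega>) (k u u x)"
      using AE_integrable_fst [OF kernel_integrable [OF uW uW]] by simp
    then show ?thesis
    proof (rule AE_mp, intro AE_I2 impI)
      fix x assume "x \<in> space (lebesgue_on \<Omega>)" and int: "integrable (lebesgue_on \<Omega>) (k u u x)"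
      then have x: "x \<in> \<Omega>" by simp
      note ex = ex [OF x]
      define Q where "Q = integral {x..x + e x} (\<lambda>y. (u y - u x)\<^sup>2)"
      have "(M x)\<^sup>2 \<le> e x * Q"
      proof -
        have "continuous_on {x..x + e x} (\<lambda>y. \<bar>u y - u x\<bar>)"
          by (intro continuous_intros continuous_on_subset [OF u] ex)
        from Cauchy_Schwarz_interval [OF this] ex(1) show ?thesis by (simp add: M_def Q_def)
      qed
      moreover have "16 * Q / (e x) ^ 3 \<le> K * I x"
      proof -
        have "(3 - \<beta>) / 2 / (e x) ^ 3 * Q \<le> I x"
          unfolding Q_def I_def by (rule kernel_integral_lower_bound [OF u x int])
        then have "K * ((3 - \<beta>) / 2 / (e x) ^ 3 * Q) \<le> K * I x"
          using K by (intro mult_left_mono) auto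
        moreover have "32 / c * (c / 2 / X * Q) = 16 * Q / X" if "c \<noteq> 0" for c X :: real
          using that by simp
        ultimately show ?thesis using beta by (simp add: K_def)
      qed
      moreover have "(D x)\<^sup>2 \<le> (4 / (e x)\<^sup>2 * M x)\<^sup>2"
        using A(3) [OF x] by (metis abs_ge_zero power2_abs power_mono)
      moreover have "(4 / (e x)\<^sup>2 * M x)\<^sup>2 = 16 * (M x)\<^sup>2 / (e x) ^ 4"
        by (simp add: power_mult_distrib power_divide flip: power_mult)
      moreover have "16 * (M x)\<^sup>2 / (e x) ^ 4 \<le> 16 * (e x * Q) / (e x) ^ 4"
        using \<open>(M x)\<^sup>2 \<le> e x * Q\<close> by (intro divide_right_mono) auto
      moreover have "16 * (e x * Q) / (e x) ^ 4 = 16 * Q / (e x) ^ 3"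
        using ex by (simp add: power_def numeral_eq_Suc)
      moreover have "4 * (A x - u x)\<^sup>2 \<le> 4 * (2 / e x * M x)\<^sup>2"
        using A(4) [OF x] by (metis abs_ge_zero power2_abs power_mono mult_left_mono zero_le_numeral)
      moreover have "4 * (2 / e x * M x)\<^sup>2 = 16 * (M x)\<^sup>2 / (e x)\<^sup>2"
        by (simp add: power_mult_distrib power_divide)
      \<comment> \<open>Since e x < 1, the bound for \<open>A - u\<close> is weakened to the one
        already obtained for \<open>D\<close>.\<close>
      moreover have "16 * (M x)\<^sup>2 / (e x)\<^sup>2 \<le> 16 * (M x)\<^sup>2 / (e x) ^ 4"
        using ex by (intro divide_left_mono power_decreasing) auto
      ultimately show "(D x)\<^sup>2 \<le> K * I x \<and> 4 * (A x - u x)\<^sup>2 \<le> K * I x" by linarith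
    qed
  qed
  \<comment> \<open>The difference A - u contributes 2 L e x \<le> 2 L x, and \<open>u\<close>
    itself at most L x. This serves only to make \<open>A\<close> tend to 0 at the left end.\<close>
  have A_small: "\<bar>A x\<bar> \<le> 3 * L * x" if x: "x \<in> \<Omega>" for x
  proof -
    note ex = ex [OF x]
    have L0: "0 \<le> L" using L by (rule lipschitz_on_nonneg)
    have lip: "\<bar>u y - u z\<bar> \<le> L * \<bar>y - z\<bar>" if "y \<in> {0..1}" "z \<in> {0..1}" for y z
      using lipschitz_onD [OF L that] by (simp add: dist_real_def)
    have "continuous_on {x..x + e x} (\<lambda>y. \<bar>u y - u x\<bar>)"
      by (intro continuous_intros continuous_on_subset [OF u] ex)
    then have M_int: "(\<lambda>y. \<bar>u y - u x\<bar>) integrable_on {x..x + e x}"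
      by (rule integrable_continuous_interval)
    have "M x \<le> integral {x..x + e x} (\<lambda>y. L * e x)"
      unfolding M_def
    proof (rule integral_le)
      fix y assume y: "y \<in> {x..x + e x}"
      then have "\<bar>u y - u x\<bar> \<le> L * \<bar>y - x\<bar>" using lip [of y x] ex x by auto
      also have "\<dots> \<le> L * e x" using y L0 by (intro mult_left_mono) auto
      finally show "\<bar>u y - u x\<bar> \<le> L * e x" .
    qed (use M_int in auto)
    also have "\<dots> = e x * (L * e x)" using ex by simp
    finally have "2 / e x * M x \<le> 2 / e x * (e x * (L * e x))" using ex by (intro mult_left_mono) auto
    also have "\<dots> = 2 * L * e x" using ex by simp
    also have "\<dots> \<le> 2 * L * x" using eta_le [OF x] L0 by (intro mult_left_mono) auto
    finally have "\<bar>A x - u x\<bar> \<le> 2 * L * x" using A(4) [OF x] by linarith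
    moreover have "\<bar>u x\<bar> \<le> L * x" using lip [of x 0] x u0 by simp
    ultimately show ?thesis by linarith
  qed
  have A2: "(A x)\<^sup>2 \<le> K * B u u" if x: "x \<in> \<Omega>" for x
  proof -
    \<comment> \<open>\<open>A\<close> is differentiable inside the interval only, so it is compared
      with its value at an interior point \<open>s\<close>.\<close>
    have step: "\<bar>A x - A s\<bar> \<le> sqrt (K * B u u)" if s: "0 < s" "s < x" for s
    proof -
      have sub: "{s..x} \<subseteq> \<Omega>" using x s by auto
      have Dc: "continuous_on {s..x} D" by (rule continuous_on_subset [OF A(2) sub])
      have "(D has_integral (A x - A s)) {s..x}"
        using A(1) sub s by (intro fundamental_theorem_of_calculus)
          (auto simp flip: has_real_derivative_iff_has_vector_derivative intro!: DERIV_subset [OF A(1)])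
      then have "(A x - A s)\<^sup>2 = (integral {s..x} D)\<^sup>2" by (simp add: integral_unique)
      also have "\<dots> \<le> (x - s) * integral {s..x} (\<lambda>t. (D t)\<^sup>2)"
        using s by (intro Cauchy_Schwarz_interval Dc) auto
      also have "\<dots> \<le> 1 * integral {s..x} (\<lambda>t. (D t)\<^sup>2)"
        using s x Dc by (intro mult_right_mono integral_nonneg integrable_continuous_interval continuous_intros) auto
      also have "\<dots> = (\<integral>t. indicator {s<..<x} t * (D t)\<^sup>2 \<partial>lebesgue_on \<Omega>)"
        using s x Dc by (simp add: integral_indicator_interval(2) continuous_on_power)
      also have "\<dots> \<le> (\<integral>t. K * I t \<partial>lebesgue_on \<Omega>)"
      proof (rule integral_mono_AE)
        show "integrable (lebesgue_on \<Omega>) (\<lambda>t. indicator {s<..<x} t * (D t)\<^sup>2)"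
          using s x Dc by (intro integral_indicator_interval(1) continuous_intros) auto
        show "integrable (lebesgue_on \<Omega>) (\<lambda>t. K * I t)"
          using I_int by (rule integrable_mult_right)
        show "AE t in lebesgue_on \<Omega>. indicator {s<..<x} t * (D t)\<^sup>2 \<le> K * I t"
          using bounds
        proof eventually_elim
          case (elim t)
          then have "0 \<le> K * I t" by (smt (verit) zero_le_power2)
          with elim show ?case by (simp add: indicator_def)
        qed
      qed
      also have "\<dots> = K * B u u" by (simp add: BI)
      finally show ?thesis by (metis real_sqrt_abs real_sqrt_le_iff)
    qed
    have "\<bar>A x\<bar> \<le> sqrt (K * B u u) + 3 * L * s" if s: "0 < s" "s < x" for s
      using step [OF s] A_small [of s] s x by auto
    \<comment> \<open>Letting \<open>s\<close> tend to 0 removes the Lipschitz constant from the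
      estimate.\<close>
    moreover have "((\<lambda>s. sqrt (K * B u u) + 3 * L * s) \<longlongrightarrow> sqrt (K * B u u) + 3 * L * 0) (at_right 0)"
      by (intro tendsto_intros)
    moreover have "\<forall>\<^sub>F s in at_right 0. 0 < s \<and> s < x"
      using x by (auto simp: eventually_at_right_field)
    ultimately have "\<bar>A x\<bar> \<le> sqrt (K * B u u) + 3 * L * 0"
      by (intro tendsto_lowerbound [of _ _ "at_right 0"]) (auto elim: eventually_mono)
    then have "\<bar>A x\<bar> \<le> sqrt (K * B u u)" by simp
    then have "\<bar>A x\<bar>\<^sup>2 \<le> (sqrt (K * B u u))\<^sup>2" by (rule power_mono) simp
    then show ?thesis using K B_nonneg [of u] by simp
  qed
  have "L2_inner u u = (\<integral>x. (u x)\<^sup>2 \<partial>lebesgue_on \<Omega>)"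
    by (simp add: L2_inner_def power2_eq_square)
  also have "\<dots> \<le> (\<integral>x. 2 * (K * B u u) + K / 2 * I x \<partial>lebesgue_on \<Omega>)"
  proof (rule integral_mono_AE)
    show "integrable (lebesgue_on \<Omega>) (\<lambda>x. (u x)\<^sup>2)"
      using W_subset_L2 [OF uW] by (simp add: L2_def)
    show "integrable (lebesgue_on \<Omega>) (\<lambda>x. 2 * (K * B u u) + K / 2 * I x)"
      using I_int finite_measure.integrable_const [OF finite_measure_Omega]
      by (intro Bochner_Integration.integrable_add integrable_mult_right) auto
    show "AE x in lebesgue_on \<Omega>. (u x)\<^sup>2 \<le> 2 * (K * B u u) + K / 2 * I x"
      using bounds
    proof (rule AE_mp, intro AE_I2 impI)
      fix x assume "x \<in> space (lebesgue_on \<Omega>)"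
        and b: "(D x)\<^sup>2 \<le> K * I x \<and> 4 * (A x - u x)\<^sup>2 \<le> K * I x"
      then have "(A x)\<^sup>2 \<le> K * B u u" by (intro A2) simp
      moreover have "(u x)\<^sup>2 \<le> 2 * (A x)\<^sup>2 + 2 * (A x - u x)\<^sup>2"
      proof -
        \<comment> \<open>This square is the difference of the two sides.\<close>
        have "0 \<le> (2 * A x - u x)\<^sup>2" by simp
        then show ?thesis by (simp add: power2_eq_square algebra_simps)
      qed
      moreover have "K / 2 * I x = (K * I x) / 2" by simp
      ultimately show "(u x)\<^sup>2 \<le> 2 * (K * B u u) + K / 2 * I x" using conjunct2 [OF b] by linarith
    qed
  qed
  also have "\<dots> = 2 * (K * B u u) + K / 2 * B u u"
  proof -
    have "measure (lebesgue_on \<Omega>) \<Omega> = 1" by (simp add: measure_restrict_space)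
    then show ?thesis
      using I_int finite_measure.integrable_const [OF finite_measure_Omega]
      by (subst Bochner_Integration.integral_add) (auto simp: BI)
  qed
  also have "\<dots> = 5 / 2 * K * B u u" by simp
  also have "5 / 2 * K = 80 / (3 - \<beta>)" by (simp add: K_def)
  finally show ?thesis .
qed

end

section \<open>Horizons arising from localization pairs\<close>

lemma generalized_distance_bounds:
  assumes "generalized_distance lam k0 k1 k2" "0 < k0" and x: "x \<in> \<Omega>"
  shows "0 < lam x" "lam x \<le> k1 * x" "lam x \<le> k1 * (1 - x)"
proof -
  have fr: "frontier \<Omega> = {0, 1}" by (auto simp: frontier_def)
  have lam: "continuous_on {0..1} lam"
    "\<And>x. x \<in> {0..1} \<Longrightarrow> 0 \<le> lam x \<and> inverse k0 * bdist x \<le> lam x \<and> lam x \<le> k0 * bdist x"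
    "\<And>x y. x \<in> \<Omega> \<Longrightarrow> y \<in> \<Omega> \<Longrightarrow> \<bar>lam x - lam y\<bar> \<le> k1 * \<bar>x - y\<bar>"
    using assms(1) by (auto simp: generalized_distance_def)
  have "0 < bdist x"
    unfolding bdist_def fr using x by (intro infdist_pos_not_in_closed) auto
  then have "0 < inverse k0 * bdist x" using \<open>0 < k0\<close> by simp
  then show "0 < lam x" using lam(2) [of x] x by simp
  have "lam 0 = 0" "lam 1 = 0"
    using lam(2) [of 0] lam(2) [of 1] by (auto simp: bdist_def fr)
  have "0 \<le> k1"
    using order.trans [OF abs_ge_zero lam(3) [of "1/4" "3/4"]] by simp
  then have "k1-lipschitz_on \<Omega> lam"
    using lam(3) by (auto intro!: lipschitz_onI simp: dist_real_def)
  \<comment> \<open>Extended to the endpoints by continuity, the Lipschitz bound can be compared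
    with the boundary values, which vanish together with \<open>bdist\<close>.\<close>
  then have "k1-lipschitz_on {0..1} lam"
    using lipschitz_on_closure [of k1 \<Omega> lam] lam(1) by simp
  from lipschitz_onD [OF this, of x 0] lipschitz_onD [OF this, of x 1] x
  show "lam x \<le> k1 * x" "lam x \<le> k1 * (1 - x)"
    using \<open>lam 0 = 0\<close> \<open>lam 1 = 0\<close> by (auto simp: dist_real_def)
qed

text \<open>The bound on \<delta> gives \<delta> k1 \<le> 1/3. Combined with q r \<le> r it keeps
  the horizon below a third of the distance to either endpoint, and combined with 0 \<le> q' \<le> 1
  it bounds the derivative of the horizon by 1/3.\<close>

lemma localization_pair_nonlocal_form:
  assumes beta: "0 < \<beta>" "\<beta> < 3" and pair: "localization_pair q lam Cq k0 k1 k2"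
    and delta: "0 < \<delta>" "\<delta> < delta_star Cq k0 k1"
  shows "\<exists>e'. nonlocal_form_C1 \<beta> q lam \<delta> e'"
proof -
  have k: "1 \<le> k0" "0 < k1" and gd: "generalized_distance lam k0 k1 k2"
    and lp: "localization_profile q Cq"
    using pair by (auto simp: localization_pair_def)
  obtain q1 q2 where q: "\<forall>r\<ge>0. (q has_real_derivative q1 r) (at r within {0..})"
      "\<forall>r\<ge>0. (q1 has_real_derivative q2 r) (at r within {0..})"
      "\<forall>r>0. 0 < q r \<and> q r \<le> r" "\<forall>r\<ge>0. 0 \<le> q1 r \<and> q1 r \<le> 1"
    using lp unfolding localization_profile_def by (elim conjE exE) (rule that)
  note q = q [rule_format]
  obtain l1 l2 where l: "\<forall>x\<in>\<Omega>. (lam has_real_derivative l1 x) (at x)"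
      "\<forall>x\<in>\<Omega>. (l1 has_real_derivative l2 x) (at x)"
      "\<forall>x\<in>\<Omega>. \<bar>lam x\<bar> \<le> k0 * bdist x \<and> \<bar>l1 x\<bar> \<le> k1 \<and> \<bar>l2 x\<bar> \<le> k2 / bdist x"
    using gd unfolding generalized_distance_def by (elim conjE exE) (rule that)
  note l = l [rule_format]
  have lam: "0 < lam x" "lam x \<le> k1 * x" "lam x \<le> k1 * (1 - x)" if "x \<in> \<Omega>" for x
    using generalized_distance_bounds [OF gd _ that] k by auto
  have dk: "\<delta> * k1 \<le> 1 / 3"
  proof -
    let ?m = "Max {1, k1, Cq * k0 powr log 2 Cq}"
    have m: "k1 \<le> ?m" "1 \<le> ?m" by (auto intro: Max_ge)
    have "\<delta> < inverse (3 * ?m)" using delta by (simp add: delta_star_def delta_0_def)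
    then have "\<delta> * ?m \<le> 1 / 3" using m by (simp add: field_simps)
    moreover have "\<delta> * k1 \<le> \<delta> * ?m" using m delta by (intro mult_left_mono) auto
    ultimately show ?thesis by linarith
  qed
  have eta_le: "eta q lam \<delta> x \<le> 1 / 3 * x" "eta q lam \<delta> x \<le> 1 / 3 * (1 - x)" if x: "x \<in> \<Omega>" for x
  proof -
    have q_lam: "eta q lam \<delta> x \<le> \<delta> * lam x"
      using q(3) [OF lam(1) [OF x]] delta by (simp add: eta_def)
    have "\<delta> * lam x \<le> \<delta> * (k1 * x)" "\<delta> * lam x \<le> \<delta> * (k1 * (1 - x))"
      using lam [OF x] delta by (auto intro!: mult_left_mono)
    moreover have "\<delta> * k1 * x \<le> 1 / 3 * x" "\<delta> * k1 * (1 - x) \<le> 1 / 3 * (1 - x)"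
      using x by (intro mult_right_mono dk; simp)+
    ultimately show "eta q lam \<delta> x \<le> 1 / 3 * x" "eta q lam \<delta> x \<le> 1 / 3 * (1 - x)"
      using q_lam unfolding mult.assoc by linarith+
  qed
  define e' where "e' x = \<delta> * (q1 (lam x) * l1 x)" for x
  have deriv: "(eta q lam \<delta> has_real_derivative e' x) (at x)" if x: "x \<in> \<Omega>" for x
  proof -
    \<comment> \<open>The profile is differentiable relative to the closed half-line; as lam x > 0,
      the derivative is two-sided here and the chain rule applies.\<close>
    have "at (lam x) within {0..} = at (lam x)"
      using lam(1) [OF x] by (intro at_within_interior) simp
    then have "(q has_real_derivative q1 (lam x)) (at (lam x))"
      using q(1) [of "lam x"] lam(1) [OF x] by simp
    from DERIV_cmult [OF DERIV_chain2 [OF this l(1) [OF x]], of \<delta>] show ?thesis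
      unfolding eta_def e'_def .
  qed
  have cont: "continuous_on \<Omega> g" if "\<And>x. x \<in> \<Omega> \<Longrightarrow> (g has_real_derivative g' x) (at x)" for g g' :: "real \<Rightarrow> real"
    using that by (meson DERIV_isCont continuous_at_imp_continuous_on)
  have "nonlocal_form_C1 \<beta> q lam \<delta> e'"
  proof
    show "eta q lam \<delta> \<in> borel_measurable (lebesgue_on \<Omega>)"
      by (rule continuous_on_borel_measurable_Omega [OF cont [OF deriv]])
    have q1: "continuous_on {0..} q1" using q(2) by (intro DERIV_continuous_on) auto
    have "lam ` \<Omega> \<subseteq> {0..}" using less_imp_le [OF lam(1)] by blast
    with q1 cont [OF l(1)] have "continuous_on \<Omega> (\<lambda>x. q1 (lam x))"
      by (rule continuous_on_compose2)
    then show "continuous_on \<Omega> e'"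
      unfolding e'_def by (intro continuous_on_mult continuous_on_const cont [OF l(2)])
    fix x assume x: "x \<in> \<Omega>"
    show "0 < eta q lam \<delta> x" using q(3) [OF lam(1) [OF x]] delta by (simp add: eta_def)
    show "eta q lam \<delta> x \<le> x" using eta_le(1) [OF x] x by simp
    show "x + eta q lam \<delta> x < 1" using eta_le(2) [OF x] x by simp
    show "(eta q lam \<delta> has_real_derivative e' x) (at x)" by (rule deriv [OF x])
    have "\<bar>e' x\<bar> = \<delta> * (q1 (lam x) * \<bar>l1 x\<bar>)"
      using q(4) [of "lam x"] lam(1) [OF x] delta by (simp add: e'_def abs_mult)
    also have "\<dots> \<le> \<delta> * (1 * k1)"
      using q(4) [of "lam x"] lam(1) [OF x] l(3) [OF x] delta by (intro mult_left_mono mult_mono) auto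
    finally show "\<bar>e' x\<bar> \<le> 1 / 3" using dk by simp
  qed (use beta in auto)
  then show ?thesis by (intro exI)
qed

subsection \<open>The error estimate\<close>

lemma fe_space_diff:
  assumes "v \<in> fe_space N" "w \<in> fe_space N"
  shows "(\<lambda>x. v x - w x) \<in> fe_space N"
proof -
  have "\<exists>a b. \<forall>x\<in>{(real i - 1) / real N <.. real i / real N}. v x - w x = a + b * x"
    if i: "i \<in> {1..N}" for i
  proof -
    obtain a b a' b' where
      "\<forall>x\<in>{(real i - 1) / real N <.. real i / real N}. v x = a + b * x"
      "\<forall>x\<in>{(real i - 1) / real N <.. real i / real N}. w x = a' + b' * x"
      using assms i unfolding fe_space_def by blast
    then show ?thesis
      by (intro exI [of _ "a - a'"] exI [of _ "b - b'"]) (simp add: algebra_simps)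
  qed
  with assms show ?thesis
    unfolding fe_space_def by (auto intro: continuous_on_diff)
qed

context nonlocal_form_C1
begin

lemma fe_space_subset_W: "\<lbrakk>v \<in> fe_space N; 1 \<le> N\<rbrakk> \<Longrightarrow> v \<in> W"
  using fe_space_lipschitz Lipschitz_in_W by blast

text \<open>The full energy norm is controlled by the form alone, with a constant that involves
  neither \<delta> nor \<open>N\<close>.\<close>

lemma coercivity:
  assumes "w \<in> fe_space N" "1 \<le> N"
  shows "(nrm w)\<^sup>2 \<le> (1 + 80 / (3 - \<beta>)) * B w w"
proof -
  obtain L where "L-lipschitz_on {0..1} w" using fe_space_lipschitz [OF assms] by blast
  moreover have "w 0 = 0" using assms by (simp add: fe_space_def)
  ultimately have "L2_inner w w \<le> 80 / (3 - \<beta>) * B w w" by (rule Poincare)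
  then show ?thesis by (simp add: nrm_def ip_nonneg) (simp add: ip_def distrib_right)
qed

text \<open>Handles the discrete functions outside \<open>fe_nonzero\<close>, over which the
  supremum does not range.\<close>

lemma nrm_eq_0:
  assumes "\<And>x. x \<in> \<Omega> \<Longrightarrow> w x = 0"
  shows "nrm w = 0"
proof -
  have "L2_inner w w = (\<integral>x. 0 \<partial>lebesgue_on \<Omega>)"
    unfolding L2_inner_def by (rule Bochner_Integration.integral_cong) (simp_all add: assms)
  moreover have "B w w = (\<integral>x. (\<integral>y. 0 \<partial>lebesgue_on \<Omega>) \<partial>lebesgue_on \<Omega>)"
    unfolding B_nl_def
    by (intro Bochner_Integration.integral_cong refl) (simp add: nl_integrand_def assms)
  ultimately show ?thesis by (simp add: nrm_def ip_def)
qed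

text \<open>A version with real numbers: \<open>s\<close> is any bound for the consistency
  quotients, and \<open>l\<close> stands for the right-hand side of the discrete problem. The
  constant is the coercivity constant, which bounds uh - v, plus 1 for the triangle
  inequality.\<close>

lemma Strang:
  assumes N: "1 \<le> N" and uh: "uh \<in> fe_space N" and v: "v \<in> fe_space N"
    and u0: "u0 \<in> W" and l: "\<And>w. w \<in> fe_space N \<Longrightarrow> B uh w = l w"
    and s: "0 \<le> s" "\<And>w. w \<in> fe_nonzero N \<Longrightarrow> \<bar>B u0 w - l w\<bar> \<le> s * nrm w"
  shows "nrm (\<lambda>x. uh x - u0 x) \<le> (2 + 80 / (3 - \<beta>)) * (nrm (\<lambda>x. u0 x - v x) + s)"
proof -
  let ?K = "1 + 80 / (3 - \<beta>)"
  define w where "w = (\<lambda>x. uh x - v x)"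
  have w: "w \<in> fe_space N" unfolding w_def by (rule fe_space_diff [OF uh v])
  have W: "uh \<in> W" "v \<in> W" "w \<in> W" "(\<lambda>x. u0 x - v x) \<in> W"
    using fe_space_subset_W [OF _ N] uh v w u0 W_diff by auto
  have K: "1 \<le> ?K" using beta by simp
  have nw: "nrm w \<le> ?K * (nrm (\<lambda>x. u0 x - v x) + s)"
  proof (cases "nrm w = 0")
    \<comment> \<open>The estimate for \<open>B w w\<close> is divided by the norm of
      \<open>w\<close>, so norm zero is treated apart.\<close>
    case True
    then show ?thesis using K s(1) nrm_nonneg by simp
  next
    case False
    then have "w \<in> fe_nonzero N"
      using w nrm_eq_0 [of w] by (force simp: fe_nonzero_def)
    from s(2) [OF this] have cons: "\<bar>B u0 w - l w\<bar> \<le> s * nrm w" .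
    have "B w w = B uh w - B v w" using B_diff [OF W(1-3)] by (simp add: w_def)
    also have "\<dots> = B (\<lambda>x. u0 x - v x) w - (B u0 w - l w)"
      using l [OF w] B_diff [OF u0 W(2,3)] by simp
    also have "\<dots> \<le> nrm (\<lambda>x. u0 x - v x) * nrm w + s * nrm w"
      using B_le_nrm [OF W(4,3)] cons by linarith
    finally have Bw: "B w w \<le> (nrm (\<lambda>x. u0 x - v x) + s) * nrm w" by (simp add: distrib_right)
    have "nrm w * nrm w \<le> ?K * B w w" using coercivity [OF w N] by (simp add: power2_eq_square)
    also have "\<dots> \<le> ?K * ((nrm (\<lambda>x. u0 x - v x) + s) * nrm w)"
      using K Bw by (intro mult_left_mono) auto
    finally have "nrm w * nrm w \<le> (?K * (nrm (\<lambda>x. u0 x - v x) + s)) * nrm w"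
      by (simp only: mult.assoc)
    moreover have "0 < nrm w" using False nrm_nonneg [of w] by linarith
    ultimately show ?thesis by (rule mult_right_le_imp_le)
  qed
  have "nrm (\<lambda>x. - 1 * (u0 x - v x)) = nrm (\<lambda>x. u0 x - v x)"
  proof -
    have "ip (\<lambda>x. c * u x) (\<lambda>x. c * u x) = c * (c * ip u u)" if "u \<in> W" for c u
      using ip_scale [OF that W_scale [OF that]] ip_scale [OF that that] ip_commute by metis
    from this [OF W(4), of "- 1"] show ?thesis by (simp add: nrm_def)
  qed
  moreover have "nrm (\<lambda>x. uh x - u0 x) \<le> nrm w + nrm (\<lambda>x. - 1 * (u0 x - v x))"
    using nrm_triangle [OF W(3) W_scale [OF W(4), of "- 1"]] by (simp add: w_def)
  ultimately have "nrm (\<lambda>x. uh x - u0 x) \<le> ?K * (nrm (\<lambda>x. u0 x - v x) + s) + (nrm (\<lambda>x. u0 x - v x) + s)"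
    using nw s(1) by linarith
  then show ?thesis by (simp add: algebra_simps)
qed

end

text \<open>A positive number divided by 0 is infinite, so a finite bound on the quotient forces a =
  0 when b = 0.\<close>

lemma ennreal_quotient_le_imp:
  assumes "ennreal a / ennreal b \<le> ennreal s" "0 \<le> a" "0 \<le> b" "0 \<le> s"
  shows "a \<le> s * b"
proof (cases "b = 0")
  case True
  then have "a = 0" using assms by (cases "a = 0") (auto simp: ennreal_divide_zero top_unique)
  then show ?thesis using True by simp
next
  case False
  then have "ennreal (a / b) \<le> ennreal s" using assms by (simp add: divide_ennreal)
  then show ?thesis using assms False by (simp add: ennreal_le_iff field_simps)
qed

theorem theorem4p9:
  fixes \<beta> Cq k0 k1 k2 :: real and q lam :: "real \<Rightarrow> real"
  assumes "0 < \<beta>" "\<beta> < 3"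
    and "localization_pair q lam Cq k0 k1 k2"
  shows "\<exists>C>0::real. \<forall>(\<delta>::real) (N::nat) (f::real \<Rightarrow> real) (u0::real \<Rightarrow> real) (uh::real \<Rightarrow> real).
    0 < \<delta> \<and> \<delta> < delta_star Cq k0 k1 \<and> 1 \<le> N \<and> f \<in> L2 \<and>
    u0 \<in> H2 \<inter> H1_0 \<and> local_weak_solution f u0 \<and> discrete_solution \<beta> q lam \<delta> N f uh
    \<longrightarrow> W_norm \<beta> q lam \<delta> (\<lambda>x. uh x - u0 x)
      \<le> ennreal C *
        ((INF v\<in>fe_space N. W_norm \<beta> q lam \<delta> (\<lambda>x. u0 x - v x)) +
         (SUP w\<in>fe_nonzero N.
            ennreal \<bar>B_nl \<beta> q lam \<delta> u0 w - B_local u0 w\<bar> / W_norm \<beta> q lam \<delta> w))"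
proof -
  \<comment> \<open>The constant depends on \<beta> only.\<close>
  let ?C = "2 + 80 / (3 - \<beta>)"
  have C: "0 < ?C" using assms by (simp add: add_pos_nonneg)
  show ?thesis
  proof (intro exI [of _ ?C] conjI C allI impI, elim conjE)
    fix \<delta> :: real and N :: nat and f u0 uh :: "real \<Rightarrow> real"
    assume delta: "0 < \<delta>" "\<delta> < delta_star Cq k0 k1" and N: "1 \<le> N" and f: "f \<in> L2"
      and u0: "u0 \<in> H2 \<inter> H1_0" "local_weak_solution f u0"
      and uh: "discrete_solution \<beta> q lam \<delta> N f uh"
    obtain e' where "nonlocal_form_C1 \<beta> q lam \<delta> e'"
      using localization_pair_nonlocal_form [OF assms delta] by (rule exE)
    then interpret nonlocal_form_C1 \<beta> q lam \<delta> e' .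
    let ?n = "W_norm \<beta> q lam \<delta>"
    let ?S = "SUP w\<in>fe_nonzero N. ennreal \<bar>B u0 w - B_local u0 w\<bar> / ?n w"
    let ?m = "INF v\<in>fe_space N. ?n (\<lambda>x. u0 x - v x)"
    \<comment> \<open>The discrete problem is restated with \<open>B_local u0\<close> as its
      right-hand side, the form in which the consistency error appears.\<close>
    have fe: "w \<in> W" "B uh w = B_local u0 w" if "w \<in> fe_space N" for w
    proof -
      show "w \<in> W" by (rule fe_space_subset_W [OF that N])
      then have "L2_inner f w = B_local u0 w"
        using u0 f by (intro local_weak_solution_strong) (auto intro: W_subset_L2)
      then show "B uh w = B_local u0 w" using uh that by (simp add: discrete_solution_def)
    qed
    have uhN: "uh \<in> fe_space N" using uh by (simp add: discrete_solution_def)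
    show "?n (\<lambda>x. uh x - u0 x) \<le> ennreal ?C * (?m + ?S)"
    proof (cases "?m = top \<or> ?S = top")
      case True
      then have "?m + ?S = top" unfolding ennreal_add_eq_top .
      then have "ennreal ?C * (?m + ?S) = top"
        using C unfolding ennreal_mult_eq_top_iff by simp
      then show ?thesis by (simp only: top_greatest)
    next
      case False
      then have fin: "?m < top" "?S < top" unfolding less_top [symmetric] by blast+
      define m s where "m = enn2real ?m" and "s = enn2real ?S"
      have m: "?m = ennreal m" "0 \<le> m" and s: "?S = ennreal s" "0 \<le> s"
        unfolding m_def s_def by (rule ennreal_enn2real [OF fin(1), symmetric] enn2real_nonneg
          ennreal_enn2real [OF fin(2), symmetric])+
      \<comment> \<open>Finiteness of the infimum yields a discrete function at finite distance from
        \<open>u0\<close>, so \<open>u0\<close> itself has finite energy. An infinite infimum makes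
        the right-hand side infinite.\<close>
      obtain v0 where v0: "v0 \<in> fe_space N" "?n (\<lambda>x. u0 x - v0 x) < top"
        using fin(1) unfolding INF_less_iff by blast
      then have "(\<lambda>x. u0 x - v0 x) \<in> W" by (auto simp: W_norm_def split: if_splits)
      then have u0W: "u0 \<in> W" using W_add [OF _ fe(1) [OF v0(1)]] by force
      have cons: "\<bar>B u0 w - B_local u0 w\<bar> \<le> s * nrm w" if w: "w \<in> fe_nonzero N" for w
      proof (rule ennreal_quotient_le_imp)
        have "?n w = ennreal (nrm w)"
          using w fe(1) by (intro W_norm_eq) (auto simp: fe_nonzero_def)
        moreover have "ennreal \<bar>B u0 w - B_local u0 w\<bar> / ?n w \<le> ?S"
          using w by (rule SUP_upper)
        ultimately show "ennreal \<bar>B u0 w - B_local u0 w\<bar> / ennreal (nrm w) \<le> ennreal s"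
          using s by simp
      qed (use s nrm_nonneg in auto)
      let ?E = "nrm (\<lambda>x. uh x - u0 x)"
      \<comment> \<open>The infimum need not be known to be attained, so the estimate is solved for
        the best approximation term and holds for every \<open>v\<close>. Should the difference be
        negative, \<open>ennreal\<close> truncates it to 0, which does no harm as m \<ge> 0.\<close>
      have "ennreal (?E / ?C - s) \<le> ?m"
      proof (rule INF_greatest)
        fix v assume v: "v \<in> fe_space N"
        have "?E \<le> ?C * (nrm (\<lambda>x. u0 x - v x) + s)"
          by (rule Strang [OF N uhN v u0W fe(2) s(2) cons])
        then have "?E / ?C \<le> nrm (\<lambda>x. u0 x - v x) + s"
          using C by (subst pos_divide_le_eq) (simp_all add: mult.commute)
        then have "ennreal (?E / ?C - s) \<le> ennreal (nrm (\<lambda>x. u0 x - v x))"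
          by (intro ennreal_leI) simp
        also have "\<dots> = ?n (\<lambda>x. u0 x - v x)"
          using W_norm_eq [OF W_diff [OF u0W fe(1) [OF v]]] by simp
        finally show "ennreal (?E / ?C - s) \<le> ?n (\<lambda>x. u0 x - v x)" .
      qed
      then have "?E / ?C - s \<le> m" using m by simp
      then have "?E \<le> ?C * (m + s)"
        using C by (subst (asm) diff_le_eq, subst (asm) pos_divide_le_eq) (simp_all add: mult.commute)
      then have "ennreal ?E \<le> ennreal ?C * (ennreal m + ennreal s)"
        using C m s by (simp flip: ennreal_plus ennreal_mult)
      then show ?thesis
        using W_norm_eq [OF W_diff [OF fe(1) [OF uhN] u0W]] m s by simp
    qed
  qed
qed

end
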